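(* Let $G\le\mathrm{Aut}(X^* )$ be a self-similar, level-transitive, regular branch group, with maximal branching subgroup $K$. The following are equivalent: (i) $G$ has trivial rigid kernel; (ii) $G$ branches over some level stabiliser; (iii) $K\ge \mathrm{St}_G(n)$ for some $n\ge1$. If $G$ is in addition self-replicating, then $\overline{G}$ is a finitely constrained group and items (i), (ii) and (iii) are also equivalent to (iv) $|X\ast G:\mathrm{St}_G(1)|=|X\ast\overline{G}:\overline{\mathrm{St}_G(1)}|$.
   Context: $X$ is a finite alphabet and $X^*$ is the set of finite words over $X$ (with empty word $\epsilon$), viewed as a regular rooted tree whose level $n$ is $X^n$. $\mathrm{Aut}(X^* )$ is its automorphism group. Each $g\in\mathrm{Aut}(X^* )$ is identified with its portrait $(g(u))_{u\in X^*}\in \mathrm{Sym}(X)^{X^*}$, where $g[x_1\cdots x_n]=y_1\cdots y_n$ with $y_i=g(x_1\cdots x_{i-1})(x_i)$; multiplication is $(fg)(u)=f(g[u])g(u)$. For $v\in X^*$ the section (shift) $g_v$ is given by $g_v(u)=g(vu)$. A group $G\le \mathrm{Aut}(X^* )$ is self-similar if $g_v\in G$ for all $g\in G$, $v\in X^*$; it is self-replicating if moreover for each $x\in X$ the map $G\to G$, $g\mapsto g_x$, is onto. It is level-transitive if it acts transitively on each $X^n$. $\mathrm{St}(n)$ is the pointwise stabiliser of $X^n$ and $\mathrm{St}_G(n)=G\cap\mathrm{St}(n)$ is the $n$-th level stabiliser. $\mathrm{Aut}(X^* )$ is a profinite group with the $\mathrm{St}(n)$ as basic neighbourhoods of the identity;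 bars denote closure in it. For $g\in\mathrm{Aut}(X^* )$, $v\in X^*$, $\delta_v(g)$ is the automorphism that acts as $g$ on the subtree rooted at $v$ and fixes the rest of $X^*$; for $H\le \mathrm{Aut}(X^* )$, $X\ast H=\prod_{x\in X}\delta_x(H)$. A self-similar group $G$ branches over $H\le G$ if $X\ast H\le H$; it is regular branch if it branches over some finite-index normal subgroup. $\mathrm{Rst}_G(v)$ is the subgroup of elements of $G$ fixing all vertices outside the subtree rooted at $v$, and $\mathrm{Rst}_G(n)=\prod_{v\in X^n}\mathrm{Rst}_G(v)$. The unique maximal branching subgroup of $G$ is $\bigcap_{u\in X^*}(\mathrm{Rst}_G(u))_u$, where $(\mathrm{Rst}_G(u))_u=\{g_u: g\in \mathrm{Rst}_G(u)\}$. The rigid kernel of $G$ is the kernel of the natural map $\varprojlim_n G/\mathrm{Rst}_G(n)\to\varprojlim_n G/\mathrm{St}_G(n)=\overline{G}$. A pattern of size $n\ge1$ is a function from $X^{<n}=\bigcup_{i<n}X^i$ to $\mathrm{Sym}(X)$; it appears in a portrait $f$ if it equals $f_u|_{X^{<n}}$ for some $u\in X^*$. A subgroup $\Gamma\le\mathrm{Aut}(X^* )=\mathrm{Sym}(X)^{X^*}$ is finitely constrained if there is a finite set of (forbidden) patterns such that $\Gamma$ is the set of all portraits in which none of these patterns appears. *)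

theory Defs
  imports
    "HOL-Algebra.Algebra"
    "HOL-Combinatorics.Perm"
    "HOL-Library.Sublist"
    "HOL-Analysis.Abstract_Topology"
begin

text \<open>
  The alphabet X is a finite type 'a, words are lists over it, and Sym(X) is the type of
  permutations of 'a. A tree automorphism is identified with its portrait, so that Aut(X*) is the
  full type of functions from words to permutations.
\<close>

type_synonym 'a portrait = "'a list \<Rightarrow> 'a Perm.perm"

definition act :: "'a portrait \<Rightarrow> 'a list \<Rightarrow> 'a list" where
  "act g u = map (\<lambda>i. Perm.apply (g (take i u)) (u ! i)) [0..<length u]"

definition Aut :: "'a::finite portrait monoid" where
  "Aut = \<lparr>carrier = UNIV, monoid.mult = (\<lambda>f g u. f (act g u) * g u), one = (\<lambda>u. 1)\<rparr>"

lemma length_act [simp]: "length (act g u) = length u"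
  by (simp add: act_def)

lemma take_act: "take i (act g u) = act g (take i u)"
  by (rule nth_equalityI) (simp_all add: act_def)

lemma act_mult: "act (f \<otimes>\<^bsub>Aut\<^esub> g) u = act f (act g u)"
proof (rule nth_equalityI)
  fix i assume "i < length (act (f \<otimes>\<^bsub>Aut\<^esub> g) u)"
  then have i: "i < length u" by simp
  have "act f (act g u) ! i = Perm.apply (f (take i (act g u))) (act g u ! i)"
    using i by (simp add: act_def)
  also have "\<dots> = act (f \<otimes>\<^bsub>Aut\<^esub> g) u ! i"
    unfolding take_act using i by (simp add: act_def Aut_def apply_times)
  finally show "act (f \<otimes>\<^bsub>Aut\<^esub> g) u ! i = act f (act g u) ! i" by simp
qed simp

lemma act_one [simp]: "act (\<lambda>u. 1) u = u"
  by (rule nth_equalityI) (simp_all add: act_def)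

lemma act_Nil [simp]: "act g [] = []"
  by (simp add: act_def)

lemma act_singleton [simp]: "act g [x] = [Perm.apply (g []) x]"
  by (simp add: act_def)

lemma act_append:
  "act g (u @ v) = act g u @ act (\<lambda>w. g (u @ w)) v"
  by (rule nth_equalityI) (auto simp: act_def nth_append)

lemma inj_act: "act g u = act g v \<Longrightarrow> u = v"
proof (induction u arbitrary: v rule: rev_induct)
  case Nil
  then have "length (act g []) = length (act g v)" by simp
  then show ?case by simp
next
  case (snoc x u)
  have "length (act g (u @ [x])) = length (act g v)" using snoc.prems by simp
  then have "length v = Suc (length u)" by simp
  then obtain w y where v: "v = w @ [y]" by (cases v rule: rev_cases) auto
  have "act g u = act g w" and xy: "Perm.apply (g u) x = Perm.apply (g w) y"
    using snoc.prems by (simp_all add: v act_append)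
  then have "u = w" using snoc.IH by blast
  then show ?case using xy by (simp add: v apply_inj)
qed

lemma surj_act: "\<exists>u. act g u = v"
proof (induction v rule: rev_induct)
  case Nil
  show ?case by (rule exI[of _ "[]"]) simp
next
  case (snoc y v)
  then obtain u where u: "act g u = v" by blast
  have "Perm.apply (g u * inverse (g u)) y = y" by simp
  then have "Perm.apply (g u) (Perm.apply (inverse (g u)) y) = y"
    by (simp only: apply_times o_apply)
  then have "act g (u @ [Perm.apply (inverse (g u)) y]) = v @ [y]"
    by (simp only: act_append act_singleton u append_Nil2)
  then show ?case by blast
qed

lemma group_Aut: "group Aut"
proof (rule groupI)
  fix f g h :: "'a portrait"
  show "f \<otimes>\<^bsub>Aut\<^esub> g \<otimes>\<^bsub>Aut\<^esub> h = f \<otimes>\<^bsub>Aut\<^esub> (g \<otimes>\<^bsub>Aut\<^esub> h)"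
  proof
    fix u
    show "(f \<otimes>\<^bsub>Aut\<^esub> g \<otimes>\<^bsub>Aut\<^esub> h) u = (f \<otimes>\<^bsub>Aut\<^esub> (g \<otimes>\<^bsub>Aut\<^esub> h)) u"
      using act_mult[of g h u] by (simp add: Aut_def mult.assoc)
  qed
  show "\<exists>k\<in>carrier Aut. k \<otimes>\<^bsub>Aut\<^esub> f = \<one>\<^bsub>Aut\<^esub>"
  proof
    let ?k = "\<lambda>v. inverse (f (inv_into UNIV (act f) v))"
    have "inv_into UNIV (act f) (act f u) = u" for u
      by (intro inv_f_f injI) (rule inj_act)
    then show "?k \<otimes>\<^bsub>Aut\<^esub> f = \<one>\<^bsub>Aut\<^esub>"
      by (simp add: Aut_def)
  qed (simp add: Aut_def)
qed (simp_all add: Aut_def)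

abbreviation grp :: "'a::finite portrait set \<Rightarrow> 'a portrait monoid" where
  "grp H \<equiv> Aut\<lparr>carrier := H\<rparr>"


definition section_at :: "'a portrait \<Rightarrow> 'a list \<Rightarrow> 'a portrait" where
  "section_at g v = (\<lambda>u. g (v @ u))"

definition self_similar :: "'a::finite portrait set \<Rightarrow> bool" where
  "self_similar G \<longleftrightarrow> subgroup G Aut \<and> (\<forall>g\<in>G. \<forall>v. section_at g v \<in> G)"

definition self_replicating :: "'a::finite portrait set \<Rightarrow> bool" where
  "self_replicating G \<longleftrightarrow> self_similar G \<and> (\<forall>x. (\<lambda>g. section_at g [x]) ` G = G)"

definition level_transitive :: "'a::finite portrait set \<Rightarrow> bool" where
  "level_transitive G \<longleftrightarrow>
    (\<forall>n u v. length u = n \<longrightarrow> length v = n \<longrightarrow> (\<exists>g\<in>G. act g u = v))"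

definition St :: "nat \<Rightarrow> 'a::finite portrait set" where
  "St n = {g. \<forall>u. length u = n \<longrightarrow> act g u = u}"

definition St_in :: "'a::finite portrait set \<Rightarrow> nat \<Rightarrow> 'a portrait set" where
  "St_in G n = G \<inter> St n"

definition aut_topology :: "'a::finite portrait topology" where
  "aut_topology = topology (\<lambda>U. \<forall>g\<in>U. \<exists>n. g <#\<^bsub>Aut\<^esub> St n \<subseteq> U)"

lemma St_antimono:
  assumes "m \<le> n"
  shows "St n \<subseteq> St m"
proof
  fix g :: "'a portrait"
  assume g: "g \<in> St n"
  have "act g u = u" if "length u = m" for u
  proof -
    let ?v = "u @ replicate (n - m) undefined"
    have "length ?v = n" using that assms by simp
    then have "act g ?v = ?v" using g by (simp add: St_def)
    then show ?thesis by (simp add: act_append)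
  qed
  then show "g \<in> St m" by (simp add: St_def)
qed

lemma openin_aut_topology:
  "openin aut_topology U \<longleftrightarrow> (\<forall>g\<in>U. \<exists>n. g <#\<^bsub>Aut\<^esub> St n \<subseteq> U)"
proof -
  have "istopology (\<lambda>U::'a portrait set. \<forall>g\<in>U. \<exists>n. g <#\<^bsub>Aut\<^esub> St n \<subseteq> U)"
    unfolding istopology_def
  proof (intro conjI allI impI ballI)
    fix S T :: "'a portrait set" and g
    assume S: "\<forall>g\<in>S. \<exists>n. g <#\<^bsub>Aut\<^esub> St n \<subseteq> S"
      and T: "\<forall>g\<in>T. \<exists>n. g <#\<^bsub>Aut\<^esub> St n \<subseteq> T" and g: "g \<in> S \<inter> T"
    from S T g obtain m n where "g <#\<^bsub>Aut\<^esub> St m \<subseteq> S" "g <#\<^bsub>Aut\<^esub> St n \<subseteq> T"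
      by blast
    moreover have "St (max m n) \<subseteq> (St m :: 'a portrait set)" "St (max m n) \<subseteq> (St n :: 'a portrait set)"
      by (simp_all add: St_antimono)
    ultimately have "g <#\<^bsub>Aut\<^esub> St (max m n) \<subseteq> S \<inter> T"
      unfolding l_coset_def by blast
    then show "\<exists>n. g <#\<^bsub>Aut\<^esub> St n \<subseteq> S \<inter> T" by blast
  next
    fix \<K> :: "'a portrait set set" and g
    assume "\<forall>K\<in>\<K>. \<forall>g\<in>K. \<exists>n. g <#\<^bsub>Aut\<^esub> St n \<subseteq> K" and "g \<in> \<Union>\<K>"
    then obtain K n where "K \<in> \<K>" "g <#\<^bsub>Aut\<^esub> St n \<subseteq> K" by (elim UnionE) blast
    then have "g <#\<^bsub>Aut\<^esub> St n \<subseteq> \<Union>\<K>" by (rule Sup_upper2)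
    then show "\<exists>n. g <#\<^bsub>Aut\<^esub> St n \<subseteq> \<Union>\<K>" ..
  qed
  then show ?thesis
    by (simp only: aut_topology_def topology_inverse')
qed

abbreviation aut_closure :: "'a::finite portrait set \<Rightarrow> 'a portrait set" where
  "aut_closure S \<equiv> Abstract_Topology.closure_of aut_topology S"


definition delta :: "'a list \<Rightarrow> 'a portrait \<Rightarrow> 'a portrait" where
  "delta v g = (\<lambda>u. if prefix v u then g (drop (length v) u) else 1)"

text \<open>
  The internal products X * H (over the letters) and Rst_G(n) (over the words of length n) have
  factors that commute elementwise, so each is the subgroup generated by its factors.
\<close>

definition star :: "'a::finite portrait set \<Rightarrow> 'a portrait set" where
  "star H = generate Aut (\<Union>x. delta [x] ` H)"

definition branches_over :: "'a::finite portrait set \<Rightarrow> 'a portrait set \<Rightarrow> bool" where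
  "branches_over G H \<longleftrightarrow> subgroup H (grp G) \<and> star H \<subseteq> H"

definition regular_branch :: "'a::finite portrait set \<Rightarrow> bool" where
  "regular_branch G \<longleftrightarrow>
    (\<exists>H. H \<lhd> grp G \<and> finite (rcosets\<^bsub>grp G\<^esub> H) \<and> branches_over G H)"

definition Rst_vertex :: "'a::finite portrait set \<Rightarrow> 'a list \<Rightarrow> 'a portrait set" where
  "Rst_vertex G v = {g \<in> G. \<forall>u. \<not> prefix v u \<longrightarrow> act g u = u}"

definition Rst :: "'a::finite portrait set \<Rightarrow> nat \<Rightarrow> 'a portrait set" where
  "Rst G n = generate Aut (\<Union>v\<in>{v. length v = n}. Rst_vertex G v)"

definition max_branching :: "'a::finite portrait set \<Rightarrow> 'a portrait set" where
  "max_branching G = (\<Inter>u. (\<lambda>g. section_at g u) ` Rst_vertex G u)"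


text \<open>
  For a descending chain N of normal subgroups, the projection from G Mod N n to G Mod N m
  (for m \<le> n) sends a coset of N n to the unique coset of N m containing it; this is
  multiplication by N m. The same holds for the map from G Mod Rst_G(n) to G Mod St_G(n).
\<close>

definition inverse_limit ::
  "('b, 'c) monoid_scheme \<Rightarrow> (nat \<Rightarrow> 'b set) \<Rightarrow> (nat \<Rightarrow> 'b set) monoid" where
  "inverse_limit G N = (product_group UNIV (\<lambda>n. G Mod N n))
    \<lparr>carrier := {c \<in> carrier (product_group UNIV (\<lambda>n. G Mod N n)).
        \<forall>m n. m \<le> n \<longrightarrow> N m <#>\<^bsub>G\<^esub> c n = c m}\<rparr>"

definition rigid_kernel :: "'a::finite portrait set \<Rightarrow> (nat \<Rightarrow> 'a portrait set) set" where
  "rigid_kernel G = kernel (inverse_limit (grp G) (Rst G)) (inverse_limit (grp G) (St_in G))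
    (\<lambda>c n. St_in G n <#>\<^bsub>grp G\<^esub> c n)"

definition trivial_rigid_kernel :: "'a::finite portrait set \<Rightarrow> bool" where
  "trivial_rigid_kernel G \<longleftrightarrow> rigid_kernel G = {\<one>\<^bsub>inverse_limit (grp G) (Rst G)\<^esub>}"


text \<open>A pattern of size n is a partial map whose domain is the set of words of length below n.\<close>

type_synonym 'a pattern = "'a list \<rightharpoonup> 'a Perm.perm"

definition is_pattern :: "'a pattern \<Rightarrow> bool" where
  "is_pattern p \<longleftrightarrow> (\<exists>n\<ge>1. dom p = {u. length u < n})"

definition appears_in :: "'a pattern \<Rightarrow> 'a portrait \<Rightarrow> bool" where
  "appears_in p f \<longleftrightarrow> (\<exists>u. p = (Some \<circ> section_at f u) |` dom p)"

definition finitely_constrained :: "'a::finite portrait set \<Rightarrow> bool" where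
  "finitely_constrained \<Gamma> \<longleftrightarrow> subgroup \<Gamma> Aut \<and>
    (\<exists>F. finite F \<and> (\<forall>p\<in>F. is_pattern p) \<and> \<Gamma> = {f. \<forall>p\<in>F. \<not> appears_in p f})"

end

theory Submission
  imports Defs "HOL-Library.Diagonal_Subsequence"
begin

text \<open>
  An element fixing everything outside the subtree at \<open>v\<close> is \<open>\<delta>\<^sub>v(k)\<close> for its section \<open>k\<close> at \<open>v\<close>, so
  the maximal branching subgroup is \<open>K = {k. \<forall>v. \<delta>\<^sub>v(k) \<in> G}\<close>, and \<open>Rst\<^sub>G(n)\<close> consists of the
  \<open>g \<in> St(n)\<close> with \<open>\<delta>\<^sub>v(g\<^sub>v) \<in> G\<close> for all \<open>v\<close> of length \<open>n\<close>. Moreover, for each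
  fixed \<open>n\<close>, branching over \<open>St\<^sub>G(n)\<close> and \<open>St\<^sub>G(n) \<le> K\<close> are the same condition
  (\<open>branches_over_St_iff\<close>), since \<open>\<delta>\<^sub>v\<close> maps \<open>St(n)\<close> into \<open>St(n)\<close>.

  Triviality of the rigid kernel means that the subgroups \<open>Rst\<^sub>G(m)\<close> and \<open>St\<^sub>G(n)\<close> are
  cofinal in each other. If \<open>St\<^sub>G(n) \<le> K\<close>, then \<open>St\<^sub>G(m + n) \<le> Rst\<^sub>G(m)\<close> section by section.
  Conversely, the regular branch property makes every \<open>G / Rst\<^sub>G(m)\<close> finite, and compactness turns a
  trivial kernel into \<open>St\<^sub>G(n) \<le> Rst\<^sub>G(m)\<close> for some \<open>n\<close>
  (\<open>St_in_subset_if_trivial_rigid_kernel\<close>). It remains to see that \<open>Rst\<^sub>G(m) \<le> K\<close> for some \<open>m\<close>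
  (\<open>Rst_subset_max_branching\<close>); this is where level-transitivity enters.

  The rest depends on one observation. Let \<open>H\<close> be a branching subgroup of finite index. The
  subgroups \<open>H St\<^sub>G(n)\<close> become constant, hence some \<open>St\<^sub>G(n)\<close> lies in the closure of \<open>H\<close>, and
  so \<open>\<delta>\<^sub>x\<close> maps it into the closure of \<open>G\<close> (\<open>delta_in_aut_closure\<close>). The closure is therefore a
  closed self-similar group that contains every \<open>\<delta>\<^sub>x(g)\<close> with \<open>g\<close> in its \<open>n\<close>-th level stabiliser,
  and such a group is determined by the patterns of size \<open>n + 1\<close> that occur in it
  (\<open>finitely_constrained_if_closed_branching\<close>).

  For the indices, \<open>St\<^sub>G(1)\<close> has finite index in \<open>X * G\<close>, and closing up maps the first coset space
  onto the second; the indices agree exactly if \<open>X * G\<close> meets the closure of \<open>St\<^sub>G(1)\<close> in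
  \<open>St\<^sub>G(1)\<close> only (\<open>index_eq_iff\<close>). Given this, the elements \<open>\<delta>\<^sub>x(g)\<close> above, which lie in \<open>X * G\<close>
  and in the closure, lie in \<open>G\<close>, so \<open>G\<close> branches over \<open>St\<^sub>G(n)\<close>. Conversely,
  if \<open>St\<^sub>G(n) \<le> K\<close>, an element of the intersection differs from an element of \<open>St\<^sub>G(1)\<close> by a
  member of \<open>X * St\<^sub>G(n)\<close>, a subgroup of \<open>G\<close>.
\<close>

section \<open>Portraits, sections and levels\<close>

lemma carrier_Aut [simp]: "carrier Aut = UNIV"
  by (simp add: Aut_def)

lemma one_Aut: "\<one>\<^bsub>Aut\<^esub> = (\<lambda>u. 1)"
  by (simp add: Aut_def)

lemma mult_Aut_apply: "(f \<otimes>\<^bsub>Aut\<^esub> g) u = f (act g u) * g u"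
  by (simp add: Aut_def)

interpretation Aut: group Aut
  by (rule group_Aut)

lemma act_one_Aut [simp]: "act \<one>\<^bsub>Aut\<^esub> u = u"
  by (simp add: one_Aut)

lemma act_inv_left [simp]: "act (inv\<^bsub>Aut\<^esub> g) (act g u) = u"
  using Aut.l_inv[of g] by (simp flip: act_mult)

lemma act_inv_right [simp]: "act g (act (inv\<^bsub>Aut\<^esub> g) u) = u"
  using Aut.r_inv[of g] by (simp flip: act_mult)

lemma act_cong: "(\<And>i. i < length u \<Longrightarrow> f (take i u) = g (take i u)) \<Longrightarrow> act f u = act g u"
  by (simp add: act_def)

lemma act_append_section: "act g (u @ v) = act g u @ act (section_at g u) v"
  by (simp add: act_append section_at_def)

lemma portrait_apply_eqI:
  assumes "\<And>x. act f (u @ [x]) = act g (u @ [x])"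
  shows "f u = g u"
  using assms by (intro perm_eqI) (simp add: act_append)

lemma act_inject: "(\<And>u. act f u = act g u) \<Longrightarrow> f = g"
  by (intro ext portrait_apply_eqI) blast

lemma section_at_Nil [simp]: "section_at g [] = g"
  by (simp add: section_at_def)

lemma section_at_section_at [simp]: "section_at (section_at g u) v = section_at g (u @ v)"
  by (simp add: section_at_def)

lemma section_one [simp]: "section_at \<one>\<^bsub>Aut\<^esub> v = \<one>\<^bsub>Aut\<^esub>"
  by (simp add: section_at_def one_Aut)

lemma section_mult:
  "section_at (f \<otimes>\<^bsub>Aut\<^esub> g) v = section_at f (act g v) \<otimes>\<^bsub>Aut\<^esub> section_at g v"
  by (rule ext) (simp add: section_at_def mult_Aut_apply act_append)

lemma section_inv: "section_at (inv\<^bsub>Aut\<^esub> g) (act g v) = inv\<^bsub>Aut\<^esub> (section_at g v)"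
  using section_mult[of "inv\<^bsub>Aut\<^esub> g" g v] by (intro Aut.inv_equality[symmetric]) auto

definition agree :: "nat \<Rightarrow> 'a portrait \<Rightarrow> 'a portrait \<Rightarrow> bool" where
  "agree n f g \<longleftrightarrow> (\<forall>u. length u = n \<longrightarrow> act f u = act g u)"

lemma agree_refl [simp]: "agree n f f"
  by (simp add: agree_def)

lemma agree_sym: "agree n f g \<Longrightarrow> agree n g f"
  by (simp add: agree_def)

lemma agree_trans: "agree n f g \<Longrightarrow> agree n g h \<Longrightarrow> agree n f h"
  by (simp add: agree_def)

lemma St_iff_agree: "g \<in> St n \<longleftrightarrow> agree n g \<one>\<^bsub>Aut\<^esub>"
  by (simp add: St_def agree_def)

text \<open>
  The action on level \<open>n\<close> is the part of the portrait strictly above level \<open>n\<close>. The action is the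
  better form for products and inverses, the portrait for sections and patterns.
\<close>

lemma agree_iff_portrait: "agree n f g \<longleftrightarrow> (\<forall>u. length u < n \<longrightarrow> f u = g u)"
proof
  assume fg: "agree n f g"
  have "f u = g u" if "length u < n" for u
  proof (rule portrait_apply_eqI)
    fix x
    \<comment> \<open>Pad \<open>u @ [x]\<close> to a word of length \<open>n\<close>; the action on a word fixes that on its prefixes.\<close>
    let ?v = "(u @ [x]) @ replicate (n - Suc (length u)) undefined"
    have "act f ?v = act g ?v" using fg that by (simp add: agree_def)
    then show "act f (u @ [x]) = act g (u @ [x])"
      by (simp only: act_append_section[of _ "u @ [x]"]) simp
  qed
  then show "\<forall>u. length u < n \<longrightarrow> f u = g u" by blast
qed (auto simp: agree_def intro!: act_cong)

lemma agree_mono: "agree n f g \<Longrightarrow> m \<le> n \<Longrightarrow> agree m f g"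
  by (simp add: agree_iff_portrait)

lemma agree_mult: "agree n f f' \<Longrightarrow> agree n g g' \<Longrightarrow> agree n (f \<otimes>\<^bsub>Aut\<^esub> g) (f' \<otimes>\<^bsub>Aut\<^esub> g')"
  by (simp add: agree_def act_mult)

lemma agree_inv: "agree n f g \<Longrightarrow> agree n (inv\<^bsub>Aut\<^esub> f) (inv\<^bsub>Aut\<^esub> g)"
  unfolding agree_def by (metis act_inv_left act_inv_right length_act)

lemma agree_mult_inv: "agree n f g \<Longrightarrow> f \<otimes>\<^bsub>Aut\<^esub> inv\<^bsub>Aut\<^esub> g \<in> St n"
  using agree_mult[OF _ agree_refl, of n f g "inv\<^bsub>Aut\<^esub> g"] by (simp add: St_iff_agree)

lemma agree_inv_mult: "agree n f g \<Longrightarrow> inv\<^bsub>Aut\<^esub> f \<otimes>\<^bsub>Aut\<^esub> g \<in> St n"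
  using agree_mult[OF agree_refl, of n g f "inv\<^bsub>Aut\<^esub> f"]
  by (simp add: St_iff_agree agree_sym)

lemma agree_add:
  "agree (m + n) f g \<longleftrightarrow>
    agree m f g \<and> (\<forall>v. length v = m \<longrightarrow> agree n (section_at f v) (section_at g v))"
proof
  assume R: "agree m f g \<and> (\<forall>v. length v = m \<longrightarrow> agree n (section_at f v) (section_at g v))"
  have "f u = g u" if "length u < m + n" for u
  proof (cases "length u < m")
    case True
    then show ?thesis using R by (simp add: agree_iff_portrait)
  next
    case False
    then have "section_at f (take m u) (drop m u) = section_at g (take m u) (drop m u)"
      using R that by (simp add: agree_iff_portrait)
    then show ?thesis by (simp add: section_at_def)
  qed
  then show "agree (m + n) f g" by (simp add: agree_iff_portrait)
qed (auto simp: agree_iff_portrait section_at_def)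

lemma portrait_eqI:
  fixes f g :: "'a portrait"
  assumes "agree n f g" and "\<And>v. length v = n \<Longrightarrow> section_at f v = section_at g v"
  shows "f = g"
proof (rule act_inject)
  fix u :: "'a list"
  have "agree (n + length u) f g" using assms by (simp add: agree_add)
  then have "agree (length u) f g" by (rule agree_mono) simp
  then show "act f u = act g u" by (simp add: agree_def)
qed

lemma subgroup_St: "subgroup (St n) Aut"
proof (rule Aut.subgroupI)
  have "\<one>\<^bsub>Aut\<^esub> \<in> St n" by (simp add: St_iff_agree)
  then show "St n \<noteq> {}" by blast
qed (use agree_mult[of n _ "\<one>\<^bsub>Aut\<^esub>" _ "\<one>\<^bsub>Aut\<^esub>"] agree_inv[of n _ "\<one>\<^bsub>Aut\<^esub>"] in
  \<open>auto simp: St_iff_agree\<close>)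

lemma act_St: "g \<in> St n \<Longrightarrow> length u = n \<Longrightarrow> act g u = u"
  by (simp add: St_def)

lemma section_St: "g \<in> St (m + n) \<Longrightarrow> length v = m \<Longrightarrow> section_at g v \<in> St n"
  using agree_add[of m n g "\<one>\<^bsub>Aut\<^esub>"] by (simp add: St_iff_agree)


section \<open>Portraits supported on one subtree\<close>

lemma section_delta:
  "length w = length v \<Longrightarrow> section_at (delta v g) w = (if w = v then g else \<one>\<^bsub>Aut\<^esub>)"
  by (auto simp: section_at_def delta_def one_Aut prefix_def)

lemma section_delta_append: "section_at (delta (u @ v) g) u = delta v g"
  by (auto simp: section_at_def delta_def)

lemma section_delta_self [simp]: "section_at (delta v g) v = g"
  by (simp add: section_at_def delta_def)

lemma delta_Nil [simp]: "delta [] g = g"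
  by (simp add: delta_def)

lemma delta_in_St: "delta v g \<in> St (length v)"
  by (auto simp: St_iff_agree agree_iff_portrait delta_def one_Aut dest: prefix_length_le)

lemma act_delta [simp]:
  fixes g :: "'a::finite portrait"
  shows "length u = length v \<Longrightarrow> act (delta v g) u = u"
  by (rule act_St[OF delta_in_St])

lemma delta_append: "delta (u @ v) g = delta u (delta v g)"
proof (rule ext)
  fix w
  show "delta (u @ v) g w = delta u (delta v g) w"
    by (cases "prefix u w") (auto simp: delta_def prefix_def)
qed

lemma agree_delta: "agree n f g \<Longrightarrow> agree n (delta v f) (delta v g)"
  by (auto simp: agree_iff_portrait delta_def)

lemma delta_mult: "delta v (f \<otimes>\<^bsub>Aut\<^esub> g) = delta v f \<otimes>\<^bsub>Aut\<^esub> delta v g"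
  by (rule portrait_eqI[of "length v"]) (auto simp: agree_def act_mult section_mult section_delta)

lemma delta_one [simp]: "delta v \<one>\<^bsub>Aut\<^esub> = \<one>\<^bsub>Aut\<^esub>"
  by (simp add: delta_def one_Aut)

lemma delta_inv: "delta v (inv\<^bsub>Aut\<^esub> g) = inv\<^bsub>Aut\<^esub> (delta v g)"
  by (rule Aut.inv_equality[symmetric]) (simp_all flip: delta_mult)

lemma delta_conjugate:
  fixes g :: "'a::finite portrait"
  assumes "act g u = v"
  shows "g \<otimes>\<^bsub>Aut\<^esub> delta u k \<otimes>\<^bsub>Aut\<^esub> inv\<^bsub>Aut\<^esub> g
    = delta v (section_at g u \<otimes>\<^bsub>Aut\<^esub> k \<otimes>\<^bsub>Aut\<^esub> inv\<^bsub>Aut\<^esub> (section_at g u))"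
proof -
  let ?c = "section_at g u \<otimes>\<^bsub>Aut\<^esub> k \<otimes>\<^bsub>Aut\<^esub> inv\<^bsub>Aut\<^esub> (section_at g u)"
  have len: "length v = length u" using assms by auto
  have "g \<otimes>\<^bsub>Aut\<^esub> delta u k = delta v ?c \<otimes>\<^bsub>Aut\<^esub> g"
  proof (rule portrait_eqI[of "length u"])
    show "agree (length u) (g \<otimes>\<^bsub>Aut\<^esub> delta u k) (delta v ?c \<otimes>\<^bsub>Aut\<^esub> g)"
      by (simp add: agree_def act_mult len)
    fix w :: "'a list" assume w: "length w = length u"
    have "act g w = v \<longleftrightarrow> w = u" using assms inj_act by blast
    then show "section_at (g \<otimes>\<^bsub>Aut\<^esub> delta u k) w = section_at (delta v ?c \<otimes>\<^bsub>Aut\<^esub> g) w"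
      using w by (simp add: section_mult section_delta len Aut.m_assoc)
  qed
  then show ?thesis by (simp add: Aut.inv_solve_right')
qed

text \<open>
  An element of \<open>St n\<close> is the product, in any order, of its restrictions to the finitely many
  subtrees rooted at level \<open>n\<close>.
\<close>

lemma mem_if_deltas_mem:
  assumes T: "subgroup T Aut" and g: "g \<in> St n"
    and deltas: "\<And>v. length v = n \<Longrightarrow> delta v (section_at g v) \<in> T"
  shows "g \<in> T"
proof -
  \<comment> \<open>Below, \<open>r S\<close> is \<open>g\<close> restricted to the subtrees rooted in \<open>S\<close>; above level \<open>n\<close> the portrait \<open>g\<close> is trivial.\<close>
  define r where "r S = (\<lambda>u. if take n u \<in> S then g u else 1)" for S
  define L where "L = {v::'a list. length v = n}"
  have g_above: "g u = 1" if "length u < n" for u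
    using g that by (simp add: St_iff_agree agree_iff_portrait one_Aut)
  have "r S \<in> T" if "finite S" "S \<subseteq> L" for S
    using that
  proof (induction S rule: finite_induct)
    case empty
    then show ?case using subgroup.one_closed[OF T] by (simp add: r_def one_Aut)
  next
    case (insert v S)
    then have v: "length v = n" and S: "S \<subseteq> L" by (auto simp: L_def)
    have rS: "r S' \<in> St n" for S'
      by (simp add: St_iff_agree agree_iff_portrait r_def one_Aut g_above)
    have "r (insert v S) = delta v (section_at g v) \<otimes>\<^bsub>Aut\<^esub> r S"
    proof (rule portrait_eqI[of n])
      show "agree n (r (insert v S)) (delta v (section_at g v) \<otimes>\<^bsub>Aut\<^esub> r S)"
        using v by (simp add: agree_def act_mult act_St[OF rS])
      fix w :: "'a list" assume w: "length w = n"
      have "section_at (r S') w = (if w \<in> S' then section_at g w else \<one>\<^bsub>Aut\<^esub>)" for S'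
        using w by (auto simp: section_at_def r_def one_Aut)
      then show "section_at (r (insert v S)) w
          = section_at (delta v (section_at g v) \<otimes>\<^bsub>Aut\<^esub> r S) w"
        using w v insert.hyps by (simp add: section_mult act_St[OF rS] section_delta)
    qed
    then show ?case
      using insert.IH[OF S] deltas[OF v] subgroup.m_closed[OF T] by simp
  qed
  moreover have "finite L"
    unfolding L_def using finite_lists_length_eq[of "UNIV :: 'a set" n] by simp
  ultimately have "r L \<in> T" by blast
  moreover have "r L = g"
    using g_above by (auto simp: r_def L_def)
  ultimately show ?thesis by simp
qed

text \<open>
  Both internal products of the theory, \<open>star\<close> and \<open>Rst\<close>, are instances of this one; membership
  in them is thereby tested section by section.
\<close>

lemma generate_deltas:
  fixes K :: "'a::finite list \<Rightarrow> 'a portrait set"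
  assumes K: "\<And>v. length v = n \<Longrightarrow> subgroup (K v) Aut"
  shows "generate Aut (\<Union>v\<in>{v. length v = n}. delta v ` K v)
    = {g \<in> St n. \<forall>v. length v = n \<longrightarrow> section_at g v \<in> K v}" (is "generate Aut ?U = ?P")
proof
  have "subgroup ?P Aut"
  proof (rule Aut.subgroupI)
    show "?P \<noteq> {}"
      using subgroup.one_closed[OF subgroup_St] subgroup.one_closed[OF K]
      by (intro exI[of _ "\<one>\<^bsub>Aut\<^esub>"] ex_in_conv[THEN iffD1]) simp
  next
    fix g assume g: "g \<in> ?P"
    have "section_at (inv\<^bsub>Aut\<^esub> g) v \<in> K v" if "length v = n" for v
      using section_inv[of g v] act_St[of g n v] g that subgroup.m_inv_closed[OF K, of v] by simp
    then show "inv\<^bsub>Aut\<^esub> g \<in> ?P" using g subgroup.m_inv_closed[OF subgroup_St] by blast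
  next
    fix f g assume fg: "f \<in> ?P" "g \<in> ?P"
    then have "section_at (f \<otimes>\<^bsub>Aut\<^esub> g) v \<in> K v" if "length v = n" for v
      using that act_St[of g n v] subgroup.m_closed[OF K, of v] by (simp add: section_mult)
    then show "f \<otimes>\<^bsub>Aut\<^esub> g \<in> ?P" using fg subgroup.m_closed[OF subgroup_St] by blast
  qed simp
  moreover have "?U \<subseteq> ?P"
    using delta_in_St subgroup.one_closed[OF K] by (auto simp: section_delta)
  ultimately show "generate Aut ?U \<subseteq> ?P" by (intro Aut.generate_subgroup_incl)
next
  have "subgroup (generate Aut ?U) Aut" by (rule Aut.generate_is_subgroup) simp
  moreover have "delta v (section_at g v) \<in> generate Aut ?U" if "g \<in> ?P" "length v = n" for g v
    using that by (intro generate.incl) blast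
  ultimately show "?P \<subseteq> generate Aut ?U"
    using mem_if_deltas_mem[of "generate Aut ?U" _ n] by blast
qed

lemma star_eq:
  fixes H :: "'a::finite portrait set"
  assumes "subgroup H Aut"
  shows "star H = {g \<in> St 1. \<forall>x. section_at g [x] \<in> H}"
proof -
  have letters: "{v :: 'a list. length v = 1} = range (\<lambda>x. [x])"
    by (auto simp: length_Suc_conv)
  have "(\<Union>x. delta [x] ` H) = (\<Union>v\<in>{v. length v = 1}. delta v ` H)"
    unfolding letters by simp
  then have "star H = {g \<in> St 1. \<forall>v. length v = 1 \<longrightarrow> section_at g v \<in> H}"
    unfolding star_def using generate_deltas[of 1 "\<lambda>_. H"] assms by simp
  also have "\<dots> = {g \<in> St 1. \<forall>v\<in>{v. length v = 1}. section_at g v \<in> H}"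
    by simp
  finally show ?thesis unfolding letters by simp
qed

lemma subgroup_star: "subgroup (star H) Aut"
  unfolding star_def by (rule Aut.generate_is_subgroup) simp

lemma star_subset_iff:
  assumes "subgroup H Aut" and "subgroup T Aut"
  shows "star H \<subseteq> T \<longleftrightarrow> (\<forall>x. \<forall>h\<in>H. delta [x] h \<in> T)"
proof
  assume "\<forall>x. \<forall>h\<in>H. delta [x] h \<in> T"
  then show "star H \<subseteq> T"
    unfolding star_def using assms(2) by (intro Aut.generate_subgroup_incl) auto
qed (auto simp: star_def intro: generate.incl)


section \<open>Rigid stabilisers and the maximal branching subgroup\<close>

text \<open>The group \<open>(Rst\<^sub>G(v))\<^sub>v\<close> of the definition of the maximal branching subgroup.\<close>

definition rigid_section :: "'a::finite portrait set \<Rightarrow> 'a list \<Rightarrow> 'a portrait set" where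
  "rigid_section G v = {k. delta v k \<in> G}"

text \<open>
  Fixing the rest of the level of \<open>v\<close> pointwise forces \<open>v\<close> to be fixed too, and an automorphism that
  acts trivially below a fixed vertex has trivial section there; hence only the section at \<open>v\<close>
  survives.
\<close>

lemma Rst_vertex_eq: "Rst_vertex G v = delta v ` rigid_section G v"
proof
  show "Rst_vertex G v \<subseteq> delta v ` rigid_section G v"
  proof
    fix g assume g: "g \<in> Rst_vertex G v"
    then have fix_outside: "act g u = u" if "\<not> prefix v u" for u
      using that by (simp add: Rst_vertex_def)
    have same_level: "\<not> prefix v u" if "length u = length v" "u \<noteq> v" for u
      using that by (auto simp: prefix_def)
    have act_v: "act g v = v"
    proof (rule ccontr)
      assume "act g v \<noteq> v"
      then have "act g (act g v) = act g v" by (intro fix_outside same_level) simp_all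
      then show False using inj_act \<open>act g v \<noteq> v\<close> by blast
    qed
    have "g = delta v (section_at g v)"
    proof (rule portrait_eqI[of "length v"])
      show "agree (length v) g (delta v (section_at g v))"
        unfolding agree_def using act_v fix_outside same_level by (metis act_delta)
      fix w :: "'a list" assume w: "length w = length v"
      show "section_at g w = section_at (delta v (section_at g v)) w"
      proof (cases "w = v")
        case False
        have "act (section_at g w) u = u" for u
        proof -
          have "\<not> prefix v (w @ u)" using w False by (auto simp: prefix_def)
          then have "act g (w @ u) = w @ u" by (rule fix_outside)
          then show ?thesis by (simp add: act_append_section)
        qed
        then have "section_at g w = \<one>\<^bsub>Aut\<^esub>" by (intro act_inject) simp
        then show ?thesis using w False by (simp add: section_delta)
      qed simp
    qed
    then show "g \<in> delta v ` rigid_section G v"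
      using g by (auto simp: rigid_section_def Rst_vertex_def)
  qed
  have "act (delta v k) u = u" if "\<not> prefix v u" for k u
  proof -
    have "act (delta v k) u = act \<one>\<^bsub>Aut\<^esub> u"
      using that by (intro act_cong) (auto simp: delta_def one_Aut intro: prefix_order.trans take_is_prefix)
    then show ?thesis by simp
  qed
  then show "delta v ` rigid_section G v \<subseteq> Rst_vertex G v"
    by (auto simp: rigid_section_def Rst_vertex_def)
qed

lemma max_branching_eq: "max_branching G = (\<Inter>v. rigid_section G v)"
  by (simp add: max_branching_def Rst_vertex_eq image_image)

lemma mem_max_branching: "k \<in> max_branching G \<longleftrightarrow> (\<forall>v. delta v k \<in> G)"
  by (simp add: max_branching_eq rigid_section_def)

lemma subgroup_rigid_section:
  assumes "subgroup G Aut"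
  shows "subgroup (rigid_section G v) Aut"
proof (rule Aut.subgroupI)
  have "\<one>\<^bsub>Aut\<^esub> \<in> rigid_section G v"
    using subgroup.one_closed[OF assms] by (simp add: rigid_section_def)
  then show "rigid_section G v \<noteq> {}" by blast
next
  fix k assume "k \<in> rigid_section G v"
  then show "inv\<^bsub>Aut\<^esub> k \<in> rigid_section G v"
    using subgroup.m_inv_closed[OF assms] by (simp add: rigid_section_def delta_inv)
next
  fix k l assume "k \<in> rigid_section G v" "l \<in> rigid_section G v"
  then show "k \<otimes>\<^bsub>Aut\<^esub> l \<in> rigid_section G v"
    using subgroup.m_closed[OF assms] by (simp add: rigid_section_def delta_mult)
qed simp

lemma Rst_eq:
  assumes "subgroup G Aut"
  shows "Rst G n = {g \<in> St n. \<forall>v. length v = n \<longrightarrow> section_at g v \<in> rigid_section G v}"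
  unfolding Rst_def Rst_vertex_eq
  by (rule generate_deltas) (rule subgroup_rigid_section[OF assms])

lemma subgroup_Rst: "subgroup (Rst G n) Aut"
  unfolding Rst_def by (rule Aut.generate_is_subgroup) simp

lemma Rst_subset: "subgroup G Aut \<Longrightarrow> Rst G n \<subseteq> G"
  unfolding Rst_def by (rule Aut.generate_subgroup_incl) (auto simp: Rst_vertex_def)

lemma Rst_subset_St_in: "subgroup G Aut \<Longrightarrow> Rst G n \<subseteq> St_in G n"
  using Rst_subset[of G n] Rst_eq[of G n] unfolding St_in_def by blast

lemma Rst_antimono:
  fixes G :: "'a::finite portrait set"
  assumes "m \<le> n"
  shows "Rst G n \<subseteq> Rst G m"
proof -
  have "Rst_vertex G v \<subseteq> Rst_vertex G (take m v)" for v
    unfolding Rst_vertex_def by (auto intro: prefix_order.trans take_is_prefix)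
  moreover have "length (take m v) = m" if "length v = n" for v :: "'a list"
    using assms that by simp
  ultimately have
    "(\<Union>v\<in>{v. length v = n}. Rst_vertex G v) \<subseteq> (\<Union>v\<in>{v. length v = m}. Rst_vertex G v)"
    by blast
  then show ?thesis unfolding Rst_def by (rule Aut.mono_generate)
qed

lemma subgroup_St_in: "subgroup G Aut \<Longrightarrow> subgroup (St_in G n) Aut"
  unfolding St_in_def using subgroup_St by (rule Aut.subgroups_Inter_pair[rotated])

lemma self_similarD:
  assumes "self_similar G"
  shows "subgroup G Aut" and "g \<in> G \<Longrightarrow> section_at g v \<in> G"
  using assms by (simp_all add: self_similar_def)

lemma rigid_section_subset: "self_similar G \<Longrightarrow> rigid_section G v \<subseteq> G"
  using self_similarD(2)[of G "delta v _" v] by (auto simp: rigid_section_def)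

text \<open>
  The section at \<open>w\<close> of an element supported below \<open>w @ v\<close> is supported below \<open>v\<close>.
\<close>

lemma rigid_section_append: "self_similar G \<Longrightarrow> rigid_section G (w @ v) \<subseteq> rigid_section G v"
  using self_similarD(2)[of G "delta (w @ v) _" w]
  by (auto simp: rigid_section_def section_delta_append)

text \<open>
  As \<open>\<delta>\<^sub>x\<close> preserves \<open>St n\<close>, branching over \<open>St\<^sub>G(n)\<close> only asks that \<open>\<delta>\<^sub>x\<close> maps it into \<open>G\<close>.
  Iterating along a word gives membership in the maximal branching subgroup.
\<close>

lemma branches_over_St_iff:
  assumes G: "self_similar G"
  shows "branches_over G (St_in G n) \<longleftrightarrow> St_in G n \<subseteq> max_branching G"
proof -
  note sG = self_similarD(1)[OF G]
  note sSt = subgroup_St_in[OF sG, of n]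
  have "subgroup (St_in G n) (grp G)"
    using Aut.subgroup_incl[OF sSt sG] by (simp add: St_in_def)
  then have "branches_over G (St_in G n) \<longleftrightarrow> (\<forall>x. \<forall>h\<in>St_in G n. delta [x] h \<in> St_in G n)"
    by (simp add: branches_over_def star_subset_iff[OF sSt sSt])
  also have "\<dots> \<longleftrightarrow> St_in G n \<subseteq> max_branching G"
  proof
    assume step: "\<forall>x. \<forall>h\<in>St_in G n. delta [x] h \<in> St_in G n"
    have "delta v h \<in> St_in G n" if "h \<in> St_in G n" for h v
    proof (induction v)
      case (Cons x v)
      then show ?case using step delta_append[of "[x]" v h] by simp
    qed (use that in simp)
    then show "St_in G n \<subseteq> max_branching G" by (auto simp: mem_max_branching St_in_def)
  next
    assume K: "St_in G n \<subseteq> max_branching G"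
    have "delta [x] h \<in> St_in G n" if h: "h \<in> St_in G n" for x h
    proof -
      have "agree n (delta [x] h) (delta [x] \<one>\<^bsub>Aut\<^esub>)"
        using h by (intro agree_delta) (simp add: St_in_def St_iff_agree)
      then show ?thesis using K h by (auto simp: mem_max_branching St_in_def St_iff_agree)
    qed
    then show "\<forall>x. \<forall>h\<in>St_in G n. delta [x] h \<in> St_in G n" by blast
  qed
  finally show ?thesis .
qed

section \<open>A branching subgroup of finite index\<close>

lemma Aut_cancel:
  "inv\<^bsub>Aut\<^esub> a \<otimes>\<^bsub>Aut\<^esub> (a \<otimes>\<^bsub>Aut\<^esub> b) = b" "a \<otimes>\<^bsub>Aut\<^esub> (inv\<^bsub>Aut\<^esub> a \<otimes>\<^bsub>Aut\<^esub> b) = b"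
  by (simp_all flip: Aut.m_assoc)

lemma coset_eq_iff:
  assumes "subgroup H Aut"
  shows "H #>\<^bsub>Aut\<^esub> a = H #>\<^bsub>Aut\<^esub> b \<longleftrightarrow> a \<otimes>\<^bsub>Aut\<^esub> inv\<^bsub>Aut\<^esub> b \<in> H"
proof
  assume "H #>\<^bsub>Aut\<^esub> a = H #>\<^bsub>Aut\<^esub> b"
  then have "a \<in> H #>\<^bsub>Aut\<^esub> b" using Aut.rcos_self[of a H] assms by simp
  then show "a \<otimes>\<^bsub>Aut\<^esub> inv\<^bsub>Aut\<^esub> b \<in> H"
    by (auto simp: r_coset_def Aut.m_assoc)
next
  assume "a \<otimes>\<^bsub>Aut\<^esub> inv\<^bsub>Aut\<^esub> b \<in> H"
  moreover have "a = (a \<otimes>\<^bsub>Aut\<^esub> inv\<^bsub>Aut\<^esub> b) \<otimes>\<^bsub>Aut\<^esub> b" by (simp add: Aut.m_assoc)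
  ultimately have "a \<in> H #>\<^bsub>Aut\<^esub> b" unfolding r_coset_def by blast
  then show "H #>\<^bsub>Aut\<^esub> a = H #>\<^bsub>Aut\<^esub> b"
    using Aut.repr_independence[of a H b] assms by simp
qed

lemma coset_eq_self_iff:
  assumes "subgroup H Aut"
  shows "H #>\<^bsub>Aut\<^esub> a = H \<longleftrightarrow> a \<in> H"
  using coset_eq_iff[OF assms, of a "\<one>\<^bsub>Aut\<^esub>"] by simp

lemma set_mult_coset:
  assumes A: "subgroup A Aut" and B: "subgroup B Aut" and "B \<subseteq> A"
  shows "A <#>\<^bsub>Aut\<^esub> (B #>\<^bsub>Aut\<^esub> g) = A #>\<^bsub>Aut\<^esub> g"
proof -
  have "A <#>\<^bsub>Aut\<^esub> B = A"
  proof
    show "A <#>\<^bsub>Aut\<^esub> B \<subseteq> A"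
      using subgroup.m_closed[OF A] \<open>B \<subseteq> A\<close> by (auto simp: set_mult_def)
    have "a = a \<otimes>\<^bsub>Aut\<^esub> \<one>\<^bsub>Aut\<^esub>" for a :: "'a portrait" by simp
    then show "A \<subseteq> A <#>\<^bsub>Aut\<^esub> B"
      using subgroup.one_closed[OF B] unfolding set_mult_def by blast
  qed
  then show ?thesis by (simp add: Aut.setmult_rcos_assoc)
qed

text \<open>
  Numbers of cosets are compared through representatives: \<open>f\<close> and \<open>g\<close> are coset maps, or other data
  that determine a coset, and \<open>t\<close> sends representatives in \<open>A\<close> to representatives in \<open>B\<close>.
\<close>

lemma card_image_le_via:
  assumes fin: "finite (g ` B)" and t: "\<And>a. a \<in> A \<Longrightarrow> t a \<in> B"
    and separates: "\<And>a b. a \<in> A \<Longrightarrow> b \<in> A \<Longrightarrow> g (t a) = g (t b) \<Longrightarrow> f a = f b"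
  shows "finite (f ` A)" and "card (f ` A) \<le> card (g ` B)"
proof -
  define s where "s y = f (SOME a. a \<in> A \<and> g (t a) = y)" for y
  have "s (g (t a)) = f a" if "a \<in> A" for a
    unfolding s_def by (rule someI2[of _ a]) (use that separates in blast)+
  then have sub: "f ` A \<subseteq> s ` (g ` B)"
    using t by (force simp: image_image)
  show "finite (f ` A)" using finite_surj[OF fin sub] .
  show "card (f ` A) \<le> card (g ` B)" using surj_card_le[OF fin sub] .
qed

locale branching_pair =
  fixes G H :: "'a::finite portrait set"
  assumes self_similar: "self_similar G"
    and subgroup_H: "subgroup H Aut" and H_subset: "H \<subseteq> G"
    and conj_closed: "g \<in> G \<Longrightarrow> h \<in> H \<Longrightarrow> g \<otimes>\<^bsub>Aut\<^esub> h \<otimes>\<^bsub>Aut\<^esub> inv\<^bsub>Aut\<^esub> g \<in> H"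
    and finite_index: "finite ((\<lambda>g. H #>\<^bsub>Aut\<^esub> g) ` G)"
    and delta_closed: "h \<in> H \<Longrightarrow> delta [x] h \<in> H"
begin

lemmas subgroup_G = self_similarD(1)[OF self_similar]
lemmas section_closed = self_similarD(2)[OF self_similar]

lemma finite_cosets: "A \<subseteq> G \<Longrightarrow> finite ((\<lambda>g. H #>\<^bsub>Aut\<^esub> g) ` A)"
  by (rule finite_subset[OF image_mono finite_index])

lemma delta_word_closed: "h \<in> H \<Longrightarrow> delta v h \<in> H"
proof (induction v)
  case (Cons x v)
  then show ?case using delta_closed delta_append[of "[x]" v h] by simp
qed simp

lemma H_subset_rigid_section: "H \<subseteq> rigid_section G v"
  using delta_word_closed H_subset by (auto simp: rigid_section_def)

text \<open>
  Conjugation by \<open>h\<close> carries the rigid stabiliser of \<open>u\<close> into that of \<open>v\<close>; on sections it is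
  conjugation by an element of \<open>G\<close>, which permutes the cosets of the normal subgroup \<open>H\<close>.
\<close>

lemma card_rigid_section_le:
  assumes "h \<in> G" and "act h u = v"
  shows "card ((\<lambda>k. H #>\<^bsub>Aut\<^esub> k) ` rigid_section G u)
    \<le> card ((\<lambda>k. H #>\<^bsub>Aut\<^esub> k) ` rigid_section G v)"
proof -
  let ?a = "section_at h u"
  let ?t = "\<lambda>k. ?a \<otimes>\<^bsub>Aut\<^esub> k \<otimes>\<^bsub>Aut\<^esub> inv\<^bsub>Aut\<^esub> ?a"
  have a: "?a \<in> G" and inv_a: "inv\<^bsub>Aut\<^esub> ?a \<in> G"
    using section_closed assms subgroup.m_inv_closed[OF subgroup_G] by blast+
  show ?thesis
  proof (rule card_image_le_via(2)[where t = ?t])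
    show "finite ((\<lambda>k. H #>\<^bsub>Aut\<^esub> k) ` rigid_section G v)"
      by (rule finite_cosets) (rule rigid_section_subset[OF self_similar])
    fix k assume "k \<in> rigid_section G u"
    then have "delta u k \<in> G" by (simp add: rigid_section_def)
    then have "h \<otimes>\<^bsub>Aut\<^esub> delta u k \<otimes>\<^bsub>Aut\<^esub> inv\<^bsub>Aut\<^esub> h \<in> G"
      using assms(1) subgroup.m_closed[OF subgroup_G] subgroup.m_inv_closed[OF subgroup_G] by blast
    then show "?t k \<in> rigid_section G v"
      by (simp add: rigid_section_def delta_conjugate[OF assms(2)])
  next
    fix k l assume eq: "H #>\<^bsub>Aut\<^esub> ?t k = H #>\<^bsub>Aut\<^esub> ?t l"
    have "?t k \<otimes>\<^bsub>Aut\<^esub> inv\<^bsub>Aut\<^esub> ?t l = ?t (k \<otimes>\<^bsub>Aut\<^esub> inv\<^bsub>Aut\<^esub> l)"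
      by (simp add: Aut.inv_mult_group Aut.m_assoc Aut_cancel)
    then have "?t (k \<otimes>\<^bsub>Aut\<^esub> inv\<^bsub>Aut\<^esub> l) \<in> H"
      using eq coset_eq_iff[OF subgroup_H] by simp
    from conj_closed[OF inv_a this] have "k \<otimes>\<^bsub>Aut\<^esub> inv\<^bsub>Aut\<^esub> l \<in> H"
      by (simp add: Aut.m_assoc Aut_cancel)
    then show "H #>\<^bsub>Aut\<^esub> k = H #>\<^bsub>Aut\<^esub> l" using coset_eq_iff[OF subgroup_H] by simp
  qed
qed

text \<open>
  Lengthening \<open>v\<close> at the front can only shrink \<open>rigid_section G v\<close>, and by transitivity the number
  of \<open>H\<close>-cosets in this group depends on the level of \<open>v\<close> only. At a level \<open>n\<close> where that number is
  least, \<open>rigid_section G (w @ v) = rigid_section G v\<close> for all \<open>w\<close>; so the pieces \<open>\<delta>\<^sub>v(g\<^sub>v)\<close> of an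
  element \<open>g\<close> of \<open>Rst G n\<close> can be moved down to any subtree without leaving \<open>G\<close>.
\<close>

lemma Rst_subset_max_branching:
  assumes "level_transitive G"
  shows "\<exists>n. Rst G n \<subseteq> max_branching G"
proof -
  define q where "q v = (\<lambda>k. H #>\<^bsub>Aut\<^esub> k) ` rigid_section G v" for v
  obtain v where least: "\<And>u. card (q v) \<le> card (q u)"
    using ex_has_least_nat[of "\<lambda>_. True" undefined "\<lambda>v. card (q v)"] by blast
  have stable: "rigid_section G u \<subseteq> rigid_section G (w @ u)" if u: "length u = length v" for u w
  proof
    fix k assume k: "k \<in> rigid_section G u"
    obtain h where "h \<in> G" "act h u = v"
      using assms u unfolding level_transitive_def by blast
    then have "card (q u) \<le> card (q (w @ u))"
      using card_rigid_section_le[of h u v] least[of "w @ u"] by (simp add: q_def)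
    moreover have "finite (q u)"
      unfolding q_def by (rule finite_cosets) (rule rigid_section_subset[OF self_similar])
    moreover have "q (w @ u) \<subseteq> q u"
      unfolding q_def by (rule image_mono) (rule rigid_section_append[OF self_similar])
    ultimately have "q (w @ u) = q u" by (rule card_seteq[rotated 2])
    then have "H #>\<^bsub>Aut\<^esub> k \<in> q (w @ u)" using k by (simp add: q_def)
    then obtain l where l: "l \<in> rigid_section G (w @ u)" and "H #>\<^bsub>Aut\<^esub> k = H #>\<^bsub>Aut\<^esub> l"
      by (auto simp: q_def)
    then have "k \<otimes>\<^bsub>Aut\<^esub> inv\<^bsub>Aut\<^esub> l \<in> rigid_section G (w @ u)"
      using coset_eq_iff[OF subgroup_H] H_subset_rigid_section by blast
    then have "(k \<otimes>\<^bsub>Aut\<^esub> inv\<^bsub>Aut\<^esub> l) \<otimes>\<^bsub>Aut\<^esub> l \<in> rigid_section G (w @ u)"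
      using l subgroup.m_closed[OF subgroup_rigid_section[OF subgroup_G]] by blast
    then show "k \<in> rigid_section G (w @ u)" by (simp add: Aut.m_assoc)
  qed
  have "r \<in> rigid_section G w" if r: "r \<in> Rst G (length v)" for r w
  proof (rule mem_if_deltas_mem[OF subgroup_rigid_section[OF subgroup_G]])
    show "r \<in> St (length v)" using r by (simp add: Rst_eq[OF subgroup_G])
    fix u :: "'a list" assume u: "length u = length v"
    then have "section_at r u \<in> rigid_section G (w @ u)"
      using r stable by (auto simp: Rst_eq[OF subgroup_G])
    then show "delta u (section_at r u) \<in> rigid_section G w"
      by (simp add: rigid_section_def delta_append)
  qed
  then show ?thesis by (auto simp: max_branching_eq)
qed

lemma quotient_in_Rst:
  assumes "agree n f g"
    and "\<And>v. length v = n \<Longrightarrow> H #>\<^bsub>Aut\<^esub> section_at f v = H #>\<^bsub>Aut\<^esub> section_at g v"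
  shows "f \<otimes>\<^bsub>Aut\<^esub> inv\<^bsub>Aut\<^esub> g \<in> Rst G n"
proof -
  have "section_at (f \<otimes>\<^bsub>Aut\<^esub> inv\<^bsub>Aut\<^esub> g) v \<in> rigid_section G v" if v: "length v = n" for v
  proof -
    define w where "w = act (inv\<^bsub>Aut\<^esub> g) v"
    have "act g w = v" by (simp add: w_def)
    then have "section_at (inv\<^bsub>Aut\<^esub> g) v = inv\<^bsub>Aut\<^esub> (section_at g w)"
      using section_inv by metis
    then have "section_at (f \<otimes>\<^bsub>Aut\<^esub> inv\<^bsub>Aut\<^esub> g) v
        = section_at f w \<otimes>\<^bsub>Aut\<^esub> inv\<^bsub>Aut\<^esub> (section_at g w)"
      by (simp add: section_mult flip: w_def)
    moreover have "length w = n" using v by (simp add: w_def)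
    ultimately show ?thesis
      using assms(2)[of w] coset_eq_iff[OF subgroup_H] H_subset_rigid_section[of v] by auto
  qed
  then show ?thesis using agree_mult_inv[OF assms(1)] by (simp add: Rst_eq[OF subgroup_G])
qed

text \<open>
  The finite index of \<open>Rst G n\<close>, in the form in which compactness arguments use it: a coset of
  \<open>Rst G n\<close> is determined by an action on level \<open>n\<close> and finitely many \<open>H\<close>-cosets.
\<close>

lemma Rst_coset_subsequence:
  fixes g :: "nat \<Rightarrow> 'a portrait"
  assumes "\<And>i. g i \<in> G"
  shows "\<exists>r :: nat \<Rightarrow> nat. strict_mono r \<and> (\<forall>i j. g (r i) \<otimes>\<^bsub>Aut\<^esub> inv\<^bsub>Aut\<^esub> g (r j) \<in> Rst G n)"
proof -
  define L where "L = {v :: 'a list. length v = n}"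
  define Q where "Q = (\<lambda>g. H #>\<^bsub>Aut\<^esub> g) ` G"
  \<comment> \<open>The finite data that determine the coset of \<open>g i\<close>.\<close>
  define d where "d i = (\<lambda>v\<in>L. (act (g i) v, H #>\<^bsub>Aut\<^esub> section_at (g i) v))" for i
  have "finite L"
    unfolding L_def using finite_lists_length_eq[of "UNIV :: 'a set" n] by simp
  then have "finite (PiE L (\<lambda>_. L \<times> Q))"
    using finite_index by (intro finite_PiE) (simp_all add: Q_def)
  moreover have "range d \<subseteq> PiE L (\<lambda>_. L \<times> Q)"
    using section_closed assms by (simp add: d_def L_def Q_def restrict_PiE_iff image_subset_iff)
  ultimately have "finite (range d)" by (rule finite_subset[rotated])
  then obtain i0 where "infinite {i. d i = d i0}"
    using pigeonhole_infinite[of UNIV d] by auto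
  then obtain r :: "nat \<Rightarrow> nat" where r: "strict_mono r" "\<And>i. d (r i) = d i0"
    using infinite_enumerate[of "{i. d i = d i0}"] by auto
  have "g (r i) \<otimes>\<^bsub>Aut\<^esub> inv\<^bsub>Aut\<^esub> g (r j) \<in> Rst G n" for i j
  proof (rule quotient_in_Rst)
    have "d (r i) v = d (r j) v" for v using r by simp
    then have same: "act (g (r i)) v = act (g (r j)) v
        \<and> H #>\<^bsub>Aut\<^esub> section_at (g (r i)) v = H #>\<^bsub>Aut\<^esub> section_at (g (r j)) v"
      if "length v = n" for v
      using that unfolding d_def L_def by (auto dest!: meta_spec[of _ v])
    show "agree n (g (r i)) (g (r j))" using same by (simp add: agree_def)
    show "H #>\<^bsub>Aut\<^esub> section_at (g (r i)) v = H #>\<^bsub>Aut\<^esub> section_at (g (r j)) v"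
      if "length v = n" for v using same that by blast
  qed
  then show ?thesis using r(1) by blast
qed

text \<open>
  The subgroups \<open>H St\<^sub>G(n)\<close> decrease and have finite index, hence are eventually constant; an
  element of \<open>St\<^sub>G(n)\<close> for large \<open>n\<close> therefore lies in the closure of \<open>H\<close>.
\<close>

lemma St_in_approximable:
  "\<exists>n. \<forall>g\<in>St_in G n. \<forall>m. \<exists>h\<in>H. agree m g h"
proof -
  define q where "q n = (\<lambda>g. H #>\<^bsub>Aut\<^esub> g) ` St_in G n" for n
  obtain n where least: "\<And>m. card (q n) \<le> card (q m)"
    using ex_has_least_nat[of "\<lambda>_. True" undefined "\<lambda>n. card (q n)"] by blast
  have "\<exists>h\<in>H. agree m g h" if g: "g \<in> St_in G n" for g m
  proof -
    have "q (max m n) \<subseteq> q n"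
      unfolding q_def St_in_def using St_antimono[of n "max m n"] by (intro image_mono) auto
    moreover have "finite (q n)"
      unfolding q_def by (rule finite_cosets) (simp add: St_in_def)
    ultimately have "q (max m n) = q n" using least by (intro card_seteq)
    then have "H #>\<^bsub>Aut\<^esub> g \<in> q (max m n)" using g by (auto simp: q_def)
    then obtain s where s: "s \<in> St_in G (max m n)" and "H #>\<^bsub>Aut\<^esub> g = H #>\<^bsub>Aut\<^esub> s"
      by (auto simp: q_def)
    then have "g \<otimes>\<^bsub>Aut\<^esub> inv\<^bsub>Aut\<^esub> s \<in> H" using coset_eq_iff[OF subgroup_H] by simp
    moreover have "agree m s \<one>\<^bsub>Aut\<^esub>"
      using s by (auto simp: St_in_def St_iff_agree intro: agree_mono)
    then have "agree m (g \<otimes>\<^bsub>Aut\<^esub> inv\<^bsub>Aut\<^esub> s) g"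
      using agree_mult[OF agree_refl agree_inv, of m s "\<one>\<^bsub>Aut\<^esub>" g] by simp
    ultimately show ?thesis using agree_sym by blast
  qed
  then show ?thesis by blast
qed

end

section \<open>The rigid kernel\<close>

lemma grp_r_coset: "H #>\<^bsub>grp G\<^esub> g = H #>\<^bsub>Aut\<^esub> g"
  by (simp add: r_coset_def)

lemma grp_set_mult: "A <#>\<^bsub>grp G\<^esub> B = A <#>\<^bsub>Aut\<^esub> B"
  by (simp add: set_mult_def)

lemma grp_rcosets: "rcosets\<^bsub>grp G\<^esub> H = (\<lambda>g. H #>\<^bsub>Aut\<^esub> g) ` G"
  by (auto simp: RCOSETS_def grp_r_coset)

lemma one_inverse_limit: "\<one>\<^bsub>inverse_limit G N\<^esub> = N"
  by (simp add: inverse_limit_def product_group_def restrict_def)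

text \<open>
  The last conjunct says that the coset \<open>c n\<close> of \<open>Rst\<^sub>G(n)\<close> is contained in \<open>St\<^sub>G(n)\<close>.
\<close>

lemma mem_rigid_kernel:
  "c \<in> rigid_kernel G \<longleftrightarrow> (\<forall>n. c n \<in> (\<lambda>g. Rst G n #>\<^bsub>Aut\<^esub> g) ` G) \<and>
    (\<forall>m n. m \<le> n \<longrightarrow> Rst G m <#>\<^bsub>Aut\<^esub> c n = c m) \<and>
    (\<forall>n. St_in G n <#>\<^bsub>Aut\<^esub> c n = St_in G n)"
  by (auto simp: rigid_kernel_def kernel_def one_inverse_limit inverse_limit_def
      carrier_FactGroup grp_r_coset grp_set_mult PiE_iff fun_eq_iff)

lemma one_in_rigid_kernel:
  assumes "subgroup G Aut"
  shows "Rst G \<in> rigid_kernel G"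
  unfolding mem_rigid_kernel
proof (intro conjI allI impI)
  have one: "\<one>\<^bsub>Aut\<^esub> \<in> G" using subgroup.one_closed[OF assms] .
  have coset_one: "Rst G n #>\<^bsub>Aut\<^esub> \<one>\<^bsub>Aut\<^esub> = Rst G n" for n by simp
  then show "Rst G n \<in> (\<lambda>g. Rst G n #>\<^bsub>Aut\<^esub> g) ` G" for n
    using one by (metis imageI)
  show "Rst G m <#>\<^bsub>Aut\<^esub> Rst G n = Rst G m" if "m \<le> n" for m n
    using set_mult_coset[OF subgroup_Rst subgroup_Rst Rst_antimono[OF that],
        where g = "\<one>\<^bsub>Aut\<^esub>"]
    by simp
  show "St_in G n <#>\<^bsub>Aut\<^esub> Rst G n = St_in G n" for n
    using set_mult_coset[OF subgroup_St_in[OF assms] subgroup_Rst Rst_subset_St_in[OF assms],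
        where g = "\<one>\<^bsub>Aut\<^esub>"]
    by simp
qed

lemma trivial_rigid_kernel_iff:
  assumes "subgroup G Aut"
  shows "trivial_rigid_kernel G \<longleftrightarrow> rigid_kernel G \<subseteq> {Rst G}"
  using one_in_rigid_kernel[OF assms] by (auto simp: trivial_rigid_kernel_def one_inverse_limit)

lemma St_in_subset_Rst:
  assumes G: "self_similar G" and "St_in G n \<subseteq> max_branching G"
  shows "St_in G (m + n) \<subseteq> Rst G m"
proof
  fix g assume g: "g \<in> St_in G (m + n)"
  have "section_at g v \<in> rigid_section G v" if "length v = m" for v
    using assms(2) self_similarD(2)[OF G, of g v] section_St[of g m n v] g that
    by (auto simp: St_in_def max_branching_eq)
  moreover have "g \<in> St m" using g St_antimono[of m "m + n"] by (auto simp: St_in_def)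
  ultimately show "g \<in> Rst G m" by (simp add: Rst_eq[OF self_similarD(1)[OF G]])
qed

text \<open>
  In an element \<open>c\<close> of the rigid kernel, \<open>c m\<close> is determined by \<open>c n\<close> for any \<open>n \<ge> m\<close>, and
  \<open>c n\<close> is represented by an element of \<open>St\<^sub>G(n)\<close>.
\<close>

lemma trivial_rigid_kernel_if_St_in_subset:
  assumes G: "subgroup G Aut" and St_Rst: "\<And>m. \<exists>n\<ge>m. St_in G n \<subseteq> Rst G m"
  shows "trivial_rigid_kernel G"
proof -
  have "c m = Rst G m" if c: "c \<in> rigid_kernel G" for c m
  proof -
    obtain n where n: "m \<le> n" "St_in G n \<subseteq> Rst G m" using St_Rst by blast
    obtain g where g: "g \<in> G" "c n = Rst G n #>\<^bsub>Aut\<^esub> g"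
      using c unfolding mem_rigid_kernel by blast
    have "St_in G n #>\<^bsub>Aut\<^esub> g = St_in G n <#>\<^bsub>Aut\<^esub> c n"
      using set_mult_coset[OF subgroup_St_in[OF G] subgroup_Rst Rst_subset_St_in[OF G]] g by simp
    also have "\<dots> = St_in G n" using c by (simp add: mem_rigid_kernel)
    finally have "g \<in> Rst G m"
      using n coset_eq_self_iff[OF subgroup_St_in[OF G]] by blast
    moreover have "c m = Rst G m <#>\<^bsub>Aut\<^esub> c n" using c n by (simp add: mem_rigid_kernel)
    then have "c m = Rst G m #>\<^bsub>Aut\<^esub> g"
      using set_mult_coset[OF subgroup_Rst subgroup_Rst Rst_antimono] n g by simp
    ultimately show ?thesis using coset_eq_self_iff[OF subgroup_Rst] by blast
  qed
  then show ?thesis by (auto simp: trivial_rigid_kernel_iff[OF G])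
qed

context branching_pair
begin

text \<open>
  This is compactness of the inverse limit of the finite sets \<open>G / Rst\<^sub>G(n)\<close>: elements
  \<open>g n \<in> St\<^sub>G(n)\<close> outside \<open>Rst\<^sub>G(m)\<close> accumulate, along a diagonal subsequence, at a compatible
  family of cosets, and that family is a nontrivial element of the rigid kernel.
\<close>

lemma St_in_subset_if_trivial_rigid_kernel:
  assumes trivial: "trivial_rigid_kernel G"
  shows "\<exists>n. St_in G n \<subseteq> Rst G m"
proof (rule ccontr)
  assume "\<nexists>n. St_in G n \<subseteq> Rst G m"
  then have "\<forall>n. \<exists>g. g \<in> St_in G n \<and> g \<notin> Rst G m" by blast
  then obtain g where g: "\<And>n. g n \<in> St_in G n" "\<And>n. g n \<notin> Rst G m" by metis
  have gG: "g n \<in> G" for n using g(1)[of n] by (simp add: St_in_def)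
  define P where "P n s \<longleftrightarrow>
      (\<forall>i j. g (s i) \<otimes>\<^bsub>Aut\<^esub> inv\<^bsub>Aut\<^esub> g (s j) \<in> Rst G n)" for n and s :: "nat \<Rightarrow> nat"
  interpret subseqs P
  proof
    fix n and s :: "nat \<Rightarrow> nat"
    show "\<exists>r'. strict_mono r' \<and> P n (s \<circ> r')"
      using Rst_coset_subsequence[of "g \<circ> s" n] gG by (simp add: P_def)
  qed
  define a where "a i = g (diagseq i)" for i
  have cauchy: "Rst G n #>\<^bsub>Aut\<^esub> a i = Rst G n #>\<^bsub>Aut\<^esub> a j" if "i > n" "j > n" for n i j
  proof -
    have "P n (diagseq \<circ> (+) (Suc n))" by (rule diagseq_holds) (simp add: P_def)
    then have "g (diagseq (Suc n + (i - Suc n))) \<otimes>\<^bsub>Aut\<^esub>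
        inv\<^bsub>Aut\<^esub> g (diagseq (Suc n + (j - Suc n))) \<in> Rst G n"
      unfolding P_def comp_apply by blast
    then show ?thesis using that by (simp add: a_def coset_eq_iff[OF subgroup_Rst])
  qed
  have a_St: "a i \<in> St_in G n" if "n \<le> i" for i n
    using g(1)[of "diagseq i"] seq_suble[OF subseq_diagseq, of i] that
      St_antimono[of n "diagseq i"] by (auto simp: a_def St_in_def)
  define c where "c n = Rst G n #>\<^bsub>Aut\<^esub> a (Suc n)" for n
  have "c \<in> rigid_kernel G"
    unfolding mem_rigid_kernel
  proof (intro conjI allI impI)
    show "c n \<in> (\<lambda>g. Rst G n #>\<^bsub>Aut\<^esub> g) ` G" for n
      using gG by (simp add: c_def a_def)
    show "Rst G k <#>\<^bsub>Aut\<^esub> c n = c k" if "k \<le> n" for k n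
      using cauchy[of k "Suc n" "Suc k"] that
      by (simp add: c_def set_mult_coset[OF subgroup_Rst subgroup_Rst Rst_antimono])
    show "St_in G n <#>\<^bsub>Aut\<^esub> c n = St_in G n" for n
      using a_St[of n "Suc n"]
      by (simp add: c_def coset_eq_self_iff[OF subgroup_St_in[OF subgroup_G]]
          set_mult_coset[OF subgroup_St_in[OF subgroup_G] subgroup_Rst Rst_subset_St_in[OF subgroup_G]])
  qed
  then have "c = Rst G" using trivial trivial_rigid_kernel_iff[OF subgroup_G] by blast
  then have "Rst G m #>\<^bsub>Aut\<^esub> a (Suc m) = Rst G m" by (simp add: c_def fun_eq_iff)
  then show False using g(2) by (simp add: a_def coset_eq_self_iff[OF subgroup_Rst])
qed

lemma trivial_rigid_kernel_iff_St_in_subset: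
  assumes "level_transitive G"
  shows "trivial_rigid_kernel G \<longleftrightarrow> (\<exists>n. St_in G n \<subseteq> max_branching G)"
proof
  assume "trivial_rigid_kernel G"
  then show "\<exists>n. St_in G n \<subseteq> max_branching G"
    using Rst_subset_max_branching[OF assms] St_in_subset_if_trivial_rigid_kernel by (meson order_trans)
next
  assume "\<exists>n. St_in G n \<subseteq> max_branching G"
  then obtain n where "St_in G n \<subseteq> max_branching G" ..
  then have "St_in G (m + n) \<subseteq> Rst G m" for m by (rule St_in_subset_Rst[OF self_similar])
  then show "trivial_rigid_kernel G"
    using le_add1 by (intro trivial_rigid_kernel_if_St_in_subset[OF subgroup_G]) blast
qed

end

section \<open>Closures and finitely constrained groups\<close>

text \<open>
  The basic neighbourhood \<open>f St(n)\<close> consists of the portraits that agree with \<open>f\<close> on level \<open>n\<close>.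
\<close>

lemma mem_aut_closure: "f \<in> aut_closure S \<longleftrightarrow> (\<forall>n. \<exists>g\<in>S. agree n f g)"
proof -
  have coset: "h \<in> g <#\<^bsub>Aut\<^esub> St n \<longleftrightarrow> agree n h g" for g h :: "'a portrait" and n
  proof
    assume "h \<in> g <#\<^bsub>Aut\<^esub> St n"
    then obtain s where "s \<in> St n" and h: "h = g \<otimes>\<^bsub>Aut\<^esub> s" by (auto simp: l_coset_def)
    then show "agree n h g"
      using agree_mult[of n g g s "\<one>\<^bsub>Aut\<^esub>"] by (simp add: St_iff_agree)
  next
    assume "agree n h g"
    then have "inv\<^bsub>Aut\<^esub> g \<otimes>\<^bsub>Aut\<^esub> h \<in> St n" using agree_inv_mult agree_sym by blast
    moreover have "h = g \<otimes>\<^bsub>Aut\<^esub> (inv\<^bsub>Aut\<^esub> g \<otimes>\<^bsub>Aut\<^esub> h)" by (simp add: Aut_cancel)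
    ultimately show "h \<in> g <#\<^bsub>Aut\<^esub> St n" unfolding l_coset_def by blast
  qed
  have open_ball: "openin aut_topology (f <#\<^bsub>Aut\<^esub> St n)" for f :: "'a portrait" and n
    unfolding openin_aut_topology
  proof
    fix g assume "g \<in> f <#\<^bsub>Aut\<^esub> St n"
    then have "g <#\<^bsub>Aut\<^esub> St n \<subseteq> f <#\<^bsub>Aut\<^esub> St n"
      unfolding subset_iff coset using agree_trans by blast
    then show "\<exists>m. g <#\<^bsub>Aut\<^esub> St m \<subseteq> f <#\<^bsub>Aut\<^esub> St n" ..
  qed
  have "openin aut_topology (UNIV :: 'a portrait set)"
    by (simp add: openin_aut_topology)
  then have space: "f \<in> topspace aut_topology" by (metis UNIV_I openin_subset subsetD)
  show ?thesis
  proof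
    assume f: "f \<in> aut_closure S"
    show "\<forall>n. \<exists>g\<in>S. agree n f g"
    proof
      fix n
      have "f \<in> f <#\<^bsub>Aut\<^esub> St n" by (simp add: coset)
      then obtain g where "g \<in> S" "g \<in> f <#\<^bsub>Aut\<^esub> St n"
        using f open_ball[of f n] unfolding in_closure_of by blast
      then show "\<exists>g\<in>S. agree n f g" using coset agree_sym by blast
    qed
  next
    assume S: "\<forall>n. \<exists>g\<in>S. agree n f g"
    have "\<exists>g. g \<in> S \<and> g \<in> U" if U: "f \<in> U" "openin aut_topology U" for U
    proof -
      obtain n where n: "f <#\<^bsub>Aut\<^esub> St n \<subseteq> U" using U by (auto simp: openin_aut_topology)
      obtain g where "g \<in> S" "agree n f g" using S by blast
      then show ?thesis using n coset agree_sym by blast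
    qed
    then show "f \<in> aut_closure S" using space by (simp add: in_closure_of)
  qed
qed

lemma subset_aut_closure: "S \<subseteq> aut_closure S"
  using agree_refl unfolding subset_iff mem_aut_closure by blast

lemma aut_closure_mono: "S \<subseteq> T \<Longrightarrow> aut_closure S \<subseteq> aut_closure T"
  by (rule closure_of_mono)

lemma aut_closure_closed:
  assumes "\<And>n. \<exists>g\<in>aut_closure S. agree n f g"
  shows "f \<in> aut_closure S"
  unfolding mem_aut_closure
proof
  fix n
  obtain g where "g \<in> aut_closure S" "agree n f g" using assms by blast
  then show "\<exists>h\<in>S. agree n f h" using agree_trans by (fastforce simp: mem_aut_closure)
qed

lemma subgroup_aut_closure:
  assumes "subgroup G Aut"
  shows "subgroup (aut_closure G) Aut"
proof (rule Aut.subgroupI)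
  show "aut_closure G \<noteq> {}" using subset_aut_closure subgroup.one_closed[OF assms] by blast
next
  fix f assume f: "f \<in> aut_closure G"
  have "\<exists>h\<in>G. agree n (inv\<^bsub>Aut\<^esub> f) h" for n
  proof -
    obtain h where "h \<in> G" "agree n f h" using f by (auto simp: mem_aut_closure)
    then show ?thesis using agree_inv subgroup.m_inv_closed[OF assms] by blast
  qed
  then show "inv\<^bsub>Aut\<^esub> f \<in> aut_closure G" by (simp add: mem_aut_closure)
next
  fix f g assume fg: "f \<in> aut_closure G" "g \<in> aut_closure G"
  have "\<exists>h\<in>G. agree n (f \<otimes>\<^bsub>Aut\<^esub> g) h" for n
  proof -
    obtain f' where "f' \<in> G" "agree n f f'" using fg by (auto simp: mem_aut_closure)
    moreover obtain g' where "g' \<in> G" "agree n g g'" using fg by (auto simp: mem_aut_closure)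
    ultimately show ?thesis using agree_mult subgroup.m_closed[OF assms] by blast
  qed
  then show "f \<otimes>\<^bsub>Aut\<^esub> g \<in> aut_closure G" by (simp add: mem_aut_closure)
qed simp

text \<open>
  Membership in \<open>St n\<close> is decided at level \<open>n\<close>, so it passes to all close enough approximants.
\<close>

lemma closure_St_in: "aut_closure (St_in G n) = aut_closure G \<inter> St n"
proof
  have "f \<in> aut_closure G \<inter> St n" if f: "f \<in> aut_closure (St_in G n)" for f
  proof -
    obtain g where "g \<in> St_in G n" "agree n f g" using f unfolding mem_aut_closure by blast
    then have "f \<in> St n" using agree_trans by (auto simp: St_in_def St_iff_agree)
    moreover have "f \<in> aut_closure G"
      using f aut_closure_mono[of "St_in G n" G] by (auto simp: St_in_def)
    ultimately show ?thesis by blast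
  qed
  then show "aut_closure (St_in G n) \<subseteq> aut_closure G \<inter> St n" by blast
  have "\<exists>g\<in>St_in G n. agree m f g" if f: "f \<in> aut_closure G" "f \<in> St n" for f m
  proof -
    obtain g where g: "g \<in> G" "agree (max m n) f g" using f(1) unfolding mem_aut_closure by blast
    then have "agree n g f" "agree m f g" by (auto intro: agree_mono agree_sym)
    moreover from this have "g \<in> St n" using f(2) agree_trans by (simp add: St_iff_agree)
    ultimately show ?thesis using g(1) by (auto simp: St_in_def)
  qed
  then show "aut_closure G \<inter> St n \<subseteq> aut_closure (St_in G n)"
    unfolding subset_iff mem_aut_closure[of _ "St_in G n"] by blast
qed

lemma self_similar_aut_closure:
  assumes "self_similar G"
  shows "self_similar (aut_closure G)"
proof -
  have "\<exists>h\<in>G. agree n (section_at f v) h" if f: "f \<in> aut_closure G" for f v n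
  proof -
    obtain h where "h \<in> G" "agree (length v + n) f h" using f unfolding mem_aut_closure by blast
    then show ?thesis using self_similarD(2)[OF assms] agree_add by blast
  qed
  then show ?thesis
    using subgroup_aut_closure self_similarD(1)[OF assms]
    by (simp add: self_similar_def mem_aut_closure)
qed

lemma finite_perms: "finite (UNIV :: 'a::finite Perm.perm set)"
proof (rule finite_imageD)
  show "inj (Perm.apply :: 'a Perm.perm \<Rightarrow> _)" by (simp add: inj_def perm_eq_iff)
qed (rule finite_subset[OF subset_UNIV finite])

text \<open>
  The forbidden patterns are those of size \<open>n + 1\<close> that no element of \<open>\<Gamma>\<close> shows at the root.
  A portrait avoiding them is approximated level by level: if elements \<open>t x\<close> of \<open>\<Gamma>\<close> approximate its
  sections at the letters and \<open>h\<close> approximates it to level \<open>n + 1\<close>, then the section of \<open>h\<close> at \<open>x\<close>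
  differs from \<open>t x\<close> by an element of \<open>St n\<close>, so \<open>h\<close> can be corrected inside \<open>\<Gamma>\<close> to have the
  sections \<open>t x\<close>.
\<close>

lemma finitely_constrained_if_closed_branching:
  fixes \<Gamma> :: "'a::finite portrait set"
  assumes \<Gamma>: "self_similar \<Gamma>"
    and closed: "\<And>f. (\<And>l. \<exists>g\<in>\<Gamma>. agree l f g) \<Longrightarrow> f \<in> \<Gamma>"
    and branching: "\<And>g x. g \<in> St_in \<Gamma> n \<Longrightarrow> delta [x] g \<in> \<Gamma>"
  shows "finitely_constrained \<Gamma>"
proof -
  note s\<Gamma> = self_similarD(1)[OF \<Gamma>]
  define W where "W = {u :: 'a list. length u < Suc n}"
  define window where "window f = (Some \<circ> f) |` W" for f :: "'a portrait"
  have window_eq: "window f = window g \<longleftrightarrow> agree (Suc n) f g" for f g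
    by (auto simp: window_def W_def restrict_map_def fun_eq_iff agree_iff_portrait)
  have dom_window: "dom (window f) = W" for f by (auto simp: window_def)
  define F where "F = {p. dom p = W \<and> p \<notin> window ` \<Gamma>}"
  have "finite W"
    using finite_lists_length_le[of "UNIV :: 'a set" n] by (simp add: W_def less_Suc_eq_le)
  then have "finite {p :: 'a pattern. dom p = W \<and> ran p \<subseteq> UNIV}"
    using finite_perms by (rule finite_set_of_finite_maps)
  then have "finite F" by (rule finite_subset[rotated]) (auto simp: F_def)
  moreover have "\<forall>p\<in>F. is_pattern p"
    unfolding is_pattern_def by (intro ballI exI[of _ "Suc n"]) (simp add: F_def W_def)
  moreover have "\<Gamma> = {f. \<forall>p\<in>F. \<not> appears_in p f}"
  proof -
    have avoids: "(\<forall>p\<in>F. \<not> appears_in p f)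
        \<longleftrightarrow> (\<forall>u. \<exists>g\<in>\<Gamma>. agree (Suc n) (section_at f u) g)" for f
    proof -
      have "appears_in p f \<longleftrightarrow> (\<exists>u. p = window (section_at f u))" if "p \<in> F" for p
        using that by (auto simp: appears_in_def window_def F_def)
      then have "(\<forall>p\<in>F. \<not> appears_in p f) \<longleftrightarrow> (\<forall>u. window (section_at f u) \<notin> F)" by blast
      also have "\<dots> \<longleftrightarrow> (\<forall>u. \<exists>g\<in>\<Gamma>. agree (Suc n) (section_at f u) g)"
        by (auto simp: F_def dom_window image_iff window_eq)
      finally show ?thesis .
    qed
    have "f \<in> \<Gamma>" if f: "\<forall>u. \<exists>g\<in>\<Gamma>. agree (Suc n) (section_at f u) g" for f
    proof -
      have approx: "\<exists>g\<in>\<Gamma>. agree (Suc n + l) (section_at f u) g" for l u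
      proof (induction l arbitrary: u)
        case 0
        then show ?case using f by simp
      next
        case (Suc l)
        obtain h where h: "h \<in> \<Gamma>" "agree (1 + n) (section_at f u) h" using f by auto
        have "\<forall>x. \<exists>g\<in>\<Gamma>. agree (Suc n + l) (section_at f (u @ [x])) g" using Suc.IH by blast
        then obtain t where t: "\<And>x. t x \<in> \<Gamma>"
          "\<And>x. agree (Suc n + l) (section_at f (u @ [x])) (t x)" by metis
        \<comment> \<open>Right multiplication by \<open>k \<in> St 1\<close> turns the section of \<open>h\<close> at each \<open>x\<close> into \<open>t x\<close>.\<close>
        define k where
          "k w = (case w of [] \<Rightarrow> 1 | x # w' \<Rightarrow> (inv\<^bsub>Aut\<^esub> (section_at h [x]) \<otimes>\<^bsub>Aut\<^esub> t x) w')" for w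
        have section_k: "section_at k [x] = inv\<^bsub>Aut\<^esub> (section_at h [x]) \<otimes>\<^bsub>Aut\<^esub> t x" for x
          by (simp add: section_at_def k_def)
        have k: "k \<in> St 1" by (simp add: St_iff_agree agree_iff_portrait k_def one_Aut)
        have act_k: "act k [x] = [x]" for x using k by (rule act_St) simp
        have "section_at k [x] \<in> St_in \<Gamma> n" for x
        proof -
          have "agree n (section_at f (u @ [x])) (section_at h [x])"
            using h(2) agree_add[of 1 n "section_at f u" h] by simp
          then have "agree n (section_at h [x]) (t x)"
            using agree_mono[OF t(2), of n x] agree_sym agree_trans by fastforce
          then show ?thesis
            using agree_inv_mult h(1) t(1) self_similarD(2)[OF \<Gamma>] subgroup.m_closed[OF s\<Gamma>]
              subgroup.m_inv_closed[OF s\<Gamma>] by (simp add: section_k St_in_def)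
        qed
        then have "delta v (section_at k v) \<in> \<Gamma>" if "length v = 1" for v
          using that branching by (auto simp: length_Suc_conv)
        then have "k \<in> \<Gamma>" by (rule mem_if_deltas_mem[OF s\<Gamma> k])
        then have "h \<otimes>\<^bsub>Aut\<^esub> k \<in> \<Gamma>" using h(1) subgroup.m_closed[OF s\<Gamma>] by blast
        moreover have "agree (1 + (Suc n + l)) (section_at f u) (h \<otimes>\<^bsub>Aut\<^esub> k)"
          unfolding agree_add[of 1]
        proof (intro conjI allI impI)
          have "agree 1 (section_at f u) h" using h(2) by (rule agree_mono) simp
          moreover have "agree 1 h (h \<otimes>\<^bsub>Aut\<^esub> k)"
            using k by (simp add: agree_def act_mult act_St)
          ultimately show "agree 1 (section_at f u) (h \<otimes>\<^bsub>Aut\<^esub> k)" by (rule agree_trans)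
          fix v :: "'a list" assume "length v = 1"
          then obtain x where v: "v = [x]" by (auto simp: length_Suc_conv)
          have "section_at (h \<otimes>\<^bsub>Aut\<^esub> k) v = t x"
            by (simp only: v section_mult act_k section_k Aut_cancel)
          then show "agree (Suc n + l) (section_at (section_at f u) v) (section_at (h \<otimes>\<^bsub>Aut\<^esub> k) v)"
            using t(2) by (simp add: v)
        qed
        ultimately show ?case by auto
      qed
      show "f \<in> \<Gamma>"
      proof (rule closed)
        fix l
        obtain g where "g \<in> \<Gamma>" "agree (Suc n + l) f g" using approx[of l "[]"] by auto
        then show "\<exists>g\<in>\<Gamma>. agree l f g" using agree_mono[of "Suc n + l" f g l] by auto
      qed
    qed
    moreover have "\<forall>u. \<exists>g\<in>\<Gamma>. agree (Suc n) (section_at f u) g" if "f \<in> \<Gamma>" for f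
      using self_similarD(2)[OF \<Gamma> that] agree_refl by blast
    ultimately have "f \<in> \<Gamma> \<longleftrightarrow> f \<in> {f. \<forall>p\<in>F. \<not> appears_in p f}" for f
      unfolding mem_Collect_eq avoids by (rule iffI[rotated])
    then show ?thesis by (rule Set.set_eqI)
  qed
  ultimately show ?thesis unfolding finitely_constrained_def using s\<Gamma> by blast
qed

context branching_pair
begin

text \<open>
  Elements of \<open>St\<^sub>G(n)\<close> are limits of elements of \<open>H\<close> when \<open>n\<close> is large; since \<open>\<delta>\<^sub>x\<close> is continuous
  and maps \<open>H\<close> into \<open>G\<close>, it maps their limits into the closure of \<open>G\<close>.
\<close>

lemma delta_in_aut_closure:
  "\<exists>n. \<forall>x. \<forall>g\<in>St_in (aut_closure G) n. delta [x] g \<in> aut_closure G"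
proof -
  obtain n where n: "\<And>g m. g \<in> St_in G n \<Longrightarrow> \<exists>h\<in>H. agree m g h"
    using St_in_approximable by blast
  have "delta [x] g \<in> aut_closure G" if g: "g \<in> St_in (aut_closure G) n" for x g
    unfolding mem_aut_closure
  proof
    fix m
    have "g \<in> aut_closure (St_in G n)" using g by (simp add: closure_St_in St_in_def[of "aut_closure G"])
    then obtain g' where "g' \<in> St_in G n" and m: "agree m g g'"
      unfolding mem_aut_closure by blast
    then obtain h where h: "h \<in> H" "agree m g' h" using n by blast
    then have "agree m (delta [x] g) (delta [x] h)"
      using m by (intro agree_delta) (rule agree_trans)
    then show "\<exists>h\<in>G. agree m (delta [x] g) h"
      using delta_closed[OF h(1)] H_subset by blast
  qed
  then show ?thesis by blast
qed

lemma finitely_constrained_aut_closure: "finitely_constrained (aut_closure G)"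
proof -
  obtain n where "\<forall>x. \<forall>g\<in>St_in (aut_closure G) n. delta [x] g \<in> aut_closure G"
    using delta_in_aut_closure by blast
  then show ?thesis
    using self_similar_aut_closure[OF self_similar] aut_closure_closed
    by (intro finitely_constrained_if_closed_branching[where n = n]) blast+
qed

end

section \<open>Comparing indices in the group and in its closure\<close>

context branching_pair
begin

lemma St_in_1_subset_star: "St_in G 1 \<subseteq> star G"
  using section_closed by (auto simp: star_eq[OF subgroup_G] St_in_def)

lemma star_H_subset: "star H \<subseteq> H"
  using star_subset_iff[OF subgroup_H subgroup_H] delta_closed by blast

text \<open>
  For \<open>g \<in> St\<^sub>G(n)\<close> with \<open>n\<close> large, \<open>\<delta>\<^sub>x(g)\<close> lies in \<open>X * G\<close> and in the closure of \<open>St\<^sub>G(1)\<close>; the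
  hypothesis puts it back into \<open>G\<close>, so \<open>G\<close> branches over \<open>St\<^sub>G(n)\<close>.
\<close>

lemma St_in_subset_if_star_Int_closure:
  assumes "star G \<inter> aut_closure (St_in G 1) \<subseteq> St_in G 1"
  shows "\<exists>n. St_in G n \<subseteq> max_branching G"
proof -
  obtain n where n: "\<And>x g. g \<in> St_in (aut_closure G) n \<Longrightarrow> delta [x] g \<in> aut_closure G"
    using delta_in_aut_closure by blast
  have "delta [x] g \<in> St_in G n" if g: "g \<in> St_in G n" for x g
  proof -
    have "g \<in> St_in (aut_closure G) n" using g subset_aut_closure by (auto simp: St_in_def)
    then have cl: "delta [x] g \<in> aut_closure G" by (rule n)
    have "delta [x] g \<in> St 1" using delta_in_St[of "[x]" g] by simp
    then have "delta [x] g \<in> aut_closure (St_in G 1)" using cl by (simp add: closure_St_in)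
    moreover have "delta [x] g \<in> star G"
      using g unfolding star_def by (auto simp: St_in_def intro: generate.incl)
    ultimately have "delta [x] g \<in> G" using assms by (auto simp: St_in_def)
    moreover have "agree n (delta [x] g) (delta [x] \<one>\<^bsub>Aut\<^esub>)"
      using g by (intro agree_delta) (simp add: St_in_def St_iff_agree)
    ultimately show ?thesis by (simp add: St_in_def St_iff_agree)
  qed
  then have "star (St_in G n) \<subseteq> St_in G n"
    using subgroup_St_in[OF subgroup_G] by (simp add: star_subset_iff)
  moreover have "subgroup (St_in G n) (grp G)"
    using Aut.subgroup_incl[OF subgroup_St_in[OF subgroup_G] subgroup_G] by (simp add: St_in_def)
  ultimately show ?thesis
    using branches_over_St_iff[OF self_similar] unfolding branches_over_def by blast
qed

text \<open>
  An element \<open>a\<close> of the intersection agrees to level \<open>n + 1\<close> with some \<open>b \<in> St\<^sub>G(1)\<close>. The sections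
  of \<open>a b\<^sup>-\<^sup>1\<close> at the letters lie in \<open>St\<^sub>G(n)\<close>, which is contained in the maximal branching subgroup.
\<close>

lemma star_Int_closure_if_St_in_subset:
  assumes "St_in G n \<subseteq> max_branching G"
  shows "star G \<inter> aut_closure (St_in G 1) \<subseteq> St_in G 1"
proof
  fix a assume a: "a \<in> star G \<inter> aut_closure (St_in G 1)"
  then obtain b where b: "b \<in> St_in G 1" "agree (1 + n) a b"
    unfolding Int_iff mem_aut_closure by blast
  define c where "c = a \<otimes>\<^bsub>Aut\<^esub> inv\<^bsub>Aut\<^esub> b"
  have "c \<in> star G"
    using a b(1) St_in_1_subset_star subgroup_star
    unfolding c_def by (blast intro: subgroup.m_closed subgroup.m_inv_closed)
  then have c: "c \<in> St 1" "\<And>x. section_at c [x] \<in> G" by (simp_all add: star_eq[OF subgroup_G])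
  have "section_at c [x] \<in> St n" for x
    using section_St[of c 1 n "[x]"] agree_mult_inv[OF b(2)] by (simp add: c_def)
  then have "section_at c [x] \<in> max_branching G" for x
    using c assms by (auto simp: St_in_def)
  then have "delta v (section_at c v) \<in> G" if "length v = 1" for v
    using that by (auto simp: length_Suc_conv mem_max_branching)
  then have "c \<in> G" by (rule mem_if_deltas_mem[OF subgroup_G c(1)])
  then have "c \<otimes>\<^bsub>Aut\<^esub> b \<in> G"
    using b(1) subgroup.m_closed[OF subgroup_G] by (simp add: St_in_def)
  then have "a \<in> G" by (simp add: c_def Aut.m_assoc)
  then show "a \<in> St_in G 1" using a by (simp add: St_in_def star_eq[OF subgroup_G])
qed

text \<open>
  Two elements of \<open>X * G\<close> whose sections at the letters agree modulo \<open>H\<close> differ by an element of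
  \<open>X * H\<close>, which lies in \<open>G\<close>.
\<close>

lemma finite_index_in_star: "finite ((\<lambda>a. St_in G 1 #>\<^bsub>Aut\<^esub> a) ` star G)"
proof (rule card_image_le_via(1)[where t = id])
  define d where "d a = (\<lambda>x. H #>\<^bsub>Aut\<^esub> section_at a [x])" for a
  have "range (d a) \<subseteq> (\<lambda>g. H #>\<^bsub>Aut\<^esub> g) ` G" if "a \<in> star G" for a
    using that by (auto simp: d_def star_eq[OF subgroup_G])
  then have "d ` star G \<subseteq> (UNIV \<rightarrow>\<^sub>E (\<lambda>g. H #>\<^bsub>Aut\<^esub> g) ` G)"
    by (auto simp: PiE_iff)
  then show "finite (d ` star G)"
    by (rule finite_subset) (intro finite_PiE finite_index finite)
  fix a b assume ab: "a \<in> star G" "b \<in> star G" and "d (id a) = d (id b)"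
  then have same: "section_at a [x] \<otimes>\<^bsub>Aut\<^esub> inv\<^bsub>Aut\<^esub> (section_at b [x]) \<in> H" for x
    by (simp add: d_def fun_eq_iff coset_eq_iff[OF subgroup_H])
  have St1: "a \<in> St 1" "b \<in> St 1" using ab by (simp_all add: star_eq[OF subgroup_G])
  then have act_b: "act b [x] = [x]" for x by (intro act_St) simp_all
  have quotient_St: "a \<otimes>\<^bsub>Aut\<^esub> inv\<^bsub>Aut\<^esub> b \<in> St 1"
    using St1 subgroup.m_closed[OF subgroup_St] subgroup.m_inv_closed[OF subgroup_St] by blast
  have "section_at (a \<otimes>\<^bsub>Aut\<^esub> inv\<^bsub>Aut\<^esub> b) [x] \<in> H" for x
    using same[of x] section_inv[of b "[x]"] act_inv_left[of b "[x]"]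
    by (simp only: section_mult act_b)
  then have "a \<otimes>\<^bsub>Aut\<^esub> inv\<^bsub>Aut\<^esub> b \<in> star H"
    using quotient_St by (simp add: star_eq[OF subgroup_H])
  then have "a \<otimes>\<^bsub>Aut\<^esub> inv\<^bsub>Aut\<^esub> b \<in> St_in G 1"
    using star_H_subset H_subset quotient_St by (auto simp: St_in_def)
  then show "St_in G 1 #>\<^bsub>Aut\<^esub> a = St_in G 1 #>\<^bsub>Aut\<^esub> b"
    by (simp add: coset_eq_iff[OF subgroup_St_in[OF subgroup_G]])
qed simp

text \<open>
  As \<open>St\<^sub>G(1)\<close> has finitely many cosets in \<open>X * G\<close>, the closure of \<open>X * G\<close>, which is the product of
  copies of the closure of \<open>G\<close>, is the union of the closures of these cosets; so every coset of the
  closure of \<open>St\<^sub>G(1)\<close> in it meets \<open>X * G\<close>.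
\<close>

lemma closure_cosets_meet_star:
  "(\<lambda>a. aut_closure (St_in G 1) #>\<^bsub>Aut\<^esub> a) ` star (aut_closure G)
    = (\<lambda>a. aut_closure (St_in G 1) #>\<^bsub>Aut\<^esub> a) ` star G" (is "?f ` _ = ?f ` _")
proof
  have cl_G: "subgroup (aut_closure G) Aut" by (rule subgroup_aut_closure[OF subgroup_G])
  have St_G: "subgroup (St_in G 1) Aut" by (rule subgroup_St_in[OF subgroup_G])
  show "?f ` star G \<subseteq> ?f ` star (aut_closure G)"
    using subset_aut_closure
    by (intro image_mono) (auto simp: star_eq[OF subgroup_G] star_eq[OF cl_G])
  have "?f f \<in> ?f ` star G" if f: "f \<in> star (aut_closure G)" for f
  proof -
    have "\<exists>a\<in>star G. agree n f a" for n
    proof -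
      have "\<exists>g\<in>G. agree n (section_at f [x]) g" for x
        using f by (auto simp: star_eq[OF cl_G] mem_aut_closure)
      then obtain t where t: "\<And>x. t x \<in> G" "\<And>x. agree n (section_at f [x]) (t x)" by metis
      define a where "a w = (case w of [] \<Rightarrow> 1 | x # w' \<Rightarrow> t x w')" for w
      have section_a: "section_at a [x] = t x" for x by (simp add: section_at_def a_def)
      have a: "a \<in> St 1" by (simp add: St_iff_agree agree_iff_portrait a_def one_Aut)
      have "agree 1 f a"
        using f a by (simp add: star_eq[OF cl_G] St_iff_agree agree_def)
      moreover have "agree n (section_at f v) (section_at a v)" if "length v = 1" for v
        using that t(2) by (auto simp: length_Suc_conv section_a)
      ultimately have "agree (1 + n) f a" unfolding agree_add by blast
      then have "agree n f a" by (rule agree_mono) simp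
      moreover have "a \<in> star G" using a t(1) by (simp add: star_eq[OF subgroup_G] section_a)
      ultimately show ?thesis by blast
    qed
    then obtain a where a: "\<And>n. a n \<in> star G" "\<And>n. agree n f (a n)" by metis
    define c where "c n = St_in G 1 #>\<^bsub>Aut\<^esub> a n" for n
    have "finite (range c)"
      by (rule finite_subset[OF _ finite_index_in_star]) (use a(1) in \<open>auto simp: c_def\<close>)
    then obtain n0 where n0: "infinite {n. c n = c n0}"
      using pigeonhole_infinite[of UNIV c] by auto
    have "f \<otimes>\<^bsub>Aut\<^esub> inv\<^bsub>Aut\<^esub> a n0 \<in> aut_closure (St_in G 1)"
      unfolding mem_aut_closure
    proof
      fix m
      obtain n where n: "m \<le> n" "c n = c n0"
        using n0 unfolding infinite_nat_iff_unbounded_le by blast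
      then have "a n \<otimes>\<^bsub>Aut\<^esub> inv\<^bsub>Aut\<^esub> a n0 \<in> St_in G 1"
        by (simp only: c_def coset_eq_iff[OF St_G])
      moreover have "agree m (f \<otimes>\<^bsub>Aut\<^esub> inv\<^bsub>Aut\<^esub> a n0) (a n \<otimes>\<^bsub>Aut\<^esub> inv\<^bsub>Aut\<^esub> a n0)"
        using agree_mono[OF a(2) n(1)] by (intro agree_mult agree_refl)
      ultimately show "\<exists>g\<in>St_in G 1. agree m (f \<otimes>\<^bsub>Aut\<^esub> inv\<^bsub>Aut\<^esub> a n0) g" by blast
    qed
    then have "?f f = ?f (a n0)"
      by (simp only: coset_eq_iff[OF subgroup_aut_closure[OF St_G]])
    then show ?thesis using a(1) by blast
  qed
  then show "?f ` star (aut_closure G) \<subseteq> ?f ` star G" by blast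
qed

text \<open>
  Sending a coset to its product with the closure of \<open>St\<^sub>G(1)\<close> maps the first finite coset space
  onto the second, so they have the same size exactly if this map is injective.
\<close>

lemma index_eq_iff:
  "rcosets\<^bsub>grp (star G)\<^esub> (St_in G 1)
      \<approx> rcosets\<^bsub>grp (star (aut_closure G))\<^esub> (aut_closure (St_in G 1))
    \<longleftrightarrow> star G \<inter> aut_closure (St_in G 1) \<subseteq> St_in G 1"
proof -
  define S C where "S = St_in G 1" and "C = aut_closure S"
  have S: "subgroup S Aut" unfolding S_def by (rule subgroup_St_in[OF subgroup_G])
  have C: "subgroup C Aut" unfolding C_def by (rule subgroup_aut_closure[OF S])
  have star: "subgroup (star G) Aut" by (rule subgroup_star)
  let ?A = "(\<lambda>a. S #>\<^bsub>Aut\<^esub> a) ` star G"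
  have fin: "finite ?A" unfolding S_def by (rule finite_index_in_star)
  define t where "t B = C <#>\<^bsub>Aut\<^esub> B" for B
  have t: "t (S #>\<^bsub>Aut\<^esub> a) = C #>\<^bsub>Aut\<^esub> a" for a
    unfolding t_def by (rule set_mult_coset[OF C S]) (simp add: C_def subset_aut_closure)
  have "rcosets\<^bsub>grp (star (aut_closure G))\<^esub> C = t ` ?A"
    unfolding grp_rcosets
    by (simp only: S_def C_def closure_cosets_meet_star image_image t[unfolded S_def C_def])
  then have "rcosets\<^bsub>grp (star G)\<^esub> S \<approx> rcosets\<^bsub>grp (star (aut_closure G))\<^esub> C \<longleftrightarrow> ?A \<approx> t ` ?A"
    by (simp only: grp_rcosets)
  also have "\<dots> \<longleftrightarrow> inj_on t ?A"
    using fin by (auto simp: eqpoll_iff_card inj_on_iff_eq_card)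
  also have "\<dots> \<longleftrightarrow> star G \<inter> C \<subseteq> S"
  proof
    assume inj: "inj_on t ?A"
    have "a \<in> S" if "a \<in> star G" "a \<in> C" for a
    proof -
      have "C #>\<^bsub>Aut\<^esub> a = C" using that by (simp add: coset_eq_self_iff[OF C])
      then have eq: "t (S #>\<^bsub>Aut\<^esub> a) = t (S #>\<^bsub>Aut\<^esub> \<one>\<^bsub>Aut\<^esub>)" by (simp only: t) simp
      have "\<one>\<^bsub>Aut\<^esub> \<in> star G" by (rule subgroup.one_closed[OF star])
      then have "S #>\<^bsub>Aut\<^esub> a = S #>\<^bsub>Aut\<^esub> \<one>\<^bsub>Aut\<^esub>"
        by (intro inj_onD[OF inj eq] imageI that(1))
      then show ?thesis by (simp add: coset_eq_self_iff[OF S])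
    qed
    then show "star G \<inter> C \<subseteq> S" by blast
  next
    assume sub: "star G \<inter> C \<subseteq> S"
    show "inj_on t ?A"
    proof (rule inj_onI)
      fix P Q assume "P \<in> ?A" "Q \<in> ?A" and eq: "t P = t Q"
      then obtain a b where ab: "a \<in> star G" "b \<in> star G" "P = S #>\<^bsub>Aut\<^esub> a" "Q = S #>\<^bsub>Aut\<^esub> b"
        by blast
      then have "a \<otimes>\<^bsub>Aut\<^esub> inv\<^bsub>Aut\<^esub> b \<in> C" using eq by (simp add: t coset_eq_iff[OF C])
      moreover have "a \<otimes>\<^bsub>Aut\<^esub> inv\<^bsub>Aut\<^esub> b \<in> star G"
        using ab subgroup.m_closed[OF star] subgroup.m_inv_closed[OF star] by blast
      ultimately show "P = Q" using sub ab by (auto simp: coset_eq_iff[OF S])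
    qed
  qed
  finally show ?thesis unfolding S_def C_def .
qed

end

lemma branching_pair_if_regular_branch:
  assumes "self_similar G" and "regular_branch G"
  obtains H where "branching_pair G H"
proof -
  obtain H where H: "H \<lhd> grp G" "finite (rcosets\<^bsub>grp G\<^esub> H)" "branches_over G H"
    using assms(2) by (auto simp: regular_branch_def)
  note G = self_similarD(1)[OF assms(1)]
  have HG: "subgroup H (grp G)" using H(3) by (simp add: branches_over_def)
  have sH: "subgroup H Aut" by (rule Aut.incl_subgroup[OF G HG])
  have "branching_pair G H"
  proof (rule branching_pair.intro[OF assms(1) sH])
    show "H \<subseteq> G" using subgroup.subset[OF HG] by simp
    show "g \<otimes>\<^bsub>Aut\<^esub> h \<otimes>\<^bsub>Aut\<^esub> inv\<^bsub>Aut\<^esub> g \<in> H" if "g \<in> G" "h \<in> H" for g h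
      using normal.inv_op_closed2[OF H(1), of g h] that Aut.m_inv_consistent[OF G] by simp
    show "finite ((\<lambda>g. H #>\<^bsub>Aut\<^esub> g) ` G)" using H(2) by (simp add: grp_rcosets)
    show "delta [x] h \<in> H" if "h \<in> H" for x h
      using H(3) that star_subset_iff[OF sH sH] by (simp add: branches_over_def)
  qed
  then show thesis by (rule that)
qed

theorem theorem2:
  fixes G :: "'a::finite portrait set"
  assumes "subgroup G Aut" and "self_similar G" and "level_transitive G" and "regular_branch G"
  shows "(trivial_rigid_kernel G \<longleftrightarrow> (\<exists>n. branches_over G (St_in G n))) \<and>
    ((\<exists>n. branches_over G (St_in G n)) \<longleftrightarrow> (\<exists>n\<ge>1. St_in G n \<subseteq> max_branching G)) \<and>
    (self_replicating G \<longrightarrow>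
      finitely_constrained (aut_closure G) \<and>
      ((\<exists>n\<ge>1. St_in G n \<subseteq> max_branching G) \<longleftrightarrow>
        (rcosets\<^bsub>grp (star G)\<^esub> (St_in G 1)) \<approx>
          (rcosets\<^bsub>grp (star (aut_closure G))\<^esub> (aut_closure (St_in G 1)))))"
proof -
  obtain H where "branching_pair G H"
    using branching_pair_if_regular_branch assms(2,4) by blast
  then interpret branching_pair G H .
  have iii: "(\<exists>n\<ge>1. St_in G n \<subseteq> max_branching G) \<longleftrightarrow> (\<exists>n. St_in G n \<subseteq> max_branching G)"
  proof
    assume "\<exists>n. St_in G n \<subseteq> max_branching G"
    then obtain n where "St_in G n \<subseteq> max_branching G" ..
    then have "St_in G (Suc n) \<subseteq> max_branching G"
      using St_antimono[of n "Suc n"] by (auto simp: St_in_def)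
    then show "\<exists>n\<ge>1. St_in G n \<subseteq> max_branching G" by (intro exI[of _ "Suc n"]) simp
  qed blast
  have "(\<exists>n. St_in G n \<subseteq> max_branching G) \<longleftrightarrow>
      star G \<inter> aut_closure (St_in G 1) \<subseteq> St_in G 1"
    using St_in_subset_if_star_Int_closure star_Int_closure_if_St_in_subset by blast
  then show ?thesis
    unfolding iii index_eq_iff
    using trivial_rigid_kernel_iff_St_in_subset[OF assms(3)] branches_over_St_iff[OF assms(2)]
      finitely_constrained_aut_closure by simp
qed

end
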